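(* Let $F$ be a distribution function on $\mathbb{R}^m$ with univariate margins $F_1,\dots,F_m$ and copula $C_F$. Then $F$ is in the domain of attraction of some $m$-dimensional extreme value distribution (EVD) $G$ if and only if the following two conditions both hold: (a) each univariate margin $F_i$, $1\le i\le m$, is in the domain of attraction of a univariate EVD; (b) there exists a generalized Pareto distribution (GPD) $W$ on $\mathbb{R}^m$ with ultimately uniform margins, i.e. $W_i(x)=1+x$ for $x_0\le x\le 0$, $1\le i\le m$, for some $x_0<0$, such that $$C_F(\mathbf{y})=W(\mathbf{y}-\mathbf{1})+o(\|\mathbf{y}-\mathbf{1}\|)$$ uniformly for $\mathbf{y}\in[0,1]^m$.
   Context: Operations and inequalities between vectors are componentwise; $\mathbf{1}=(1,\dots,1)$, $\mathbf{0}=(0,\dots,0)$; $\|\cdot\|$ is an arbitrary norm on $\mathbb{R}^m$. A copula of $F$ is a distribution function $C_F$ on $[0,1]^m$ with uniform margins and $F(\mathbf{x})=C_F(F_1(x_1),\dots,F_m(x_m))$. Domain of attraction: $F$ is in the domain of attraction of $G$ if there are $\mathbf{a}_n>\mathbf{0}$, $\mathbf{b}_n\in\mathbb{R}^m$ with $F^n(\mathbf{a}_n\mathbf{x}+\mathbf{b}_n)\to G(\mathbf{x})$ as $n\to\infty$ for all $\mathbf{x}\in\mathbb{R}^m$. EVD: a distribution function $G$ on $\mathbb{R}^m$ with non-degenerate margins that is max-stable, i.e. for every $n\in\mathbb{N}$ there are $\mathbf{c}_n>\mathbf{0}$, $\mathbf{d}_n\in\mathbb{R}^m$ with $G^n(\mathbf{c}_n\mathbf{x}+\mathbf{d}_n)=G(\mathbf{x})$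 for all $\mathbf{x}$. The univariate EVDs are, up to location and scale, $\exp(-x^{-\alpha})$ ($x>0$), $\exp(-(-x)^{\alpha})$ ($x\le 0$), with $\alpha>0$, and $\exp(-e^{-x})$ ($x\in\mathbb{R}$). GPD: a distribution function $W$ on $\mathbb{R}^m$ whose upper tail has the form $W(\mathbf{x})=1+\log(G(\mathbf{x}))$, $\mathbf{x}\ge\mathbf{x}_0$, for some $m$-dimensional EVD $G$ and some $\mathbf{x}_0$ with $G(\mathbf{x}_0)<1$. For a GPD with ultimately uniform margins this means: there are $\mathbf{x}_0<\mathbf{0}$ and an EVD $G$ with standard negative exponential margins $G_i(x)=\exp(x)$, $x\le 0$, such that $W(\mathbf{x})=1+\log(G(\mathbf{x}))$ for $\mathbf{x}_0\le\mathbf{x}\le\mathbf{0}$. The expansion in (b) means: for every $\varepsilon>0$ there is $\delta>0$ such that $|C_F(\mathbf{y})-W(\mathbf{y}-\mathbf{1})|\le\varepsilon\|\mathbf{y}-\mathbf{1}\|$ for all $\mathbf{y}\in[0,1]^m$ with $\|\mathbf{y}-\mathbf{1}\|\le\delta$. *)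

theory Defs
  imports "HOL-Probability.Probability"
begin

text \<open>
  The order on \<open>real ^ 'n\<close> is componentwise \<open>\<le>\<close>, and \<open>*\<close>, \<open>0\<close>, \<open>1\<close> are componentwise as well.
  The library's strict order on vectors is not componentwise, so \<open>a > 0\<close> for a vector is always
  written \<open>\<forall>i. 0 < a $ i\<close>.
\<close>

definition is_norm :: "(real ^ 'n::finite \<Rightarrow> real) \<Rightarrow> bool" where
  "is_norm N \<longleftrightarrow>
     (\<forall>x. N x = 0 \<longleftrightarrow> x = 0) \<and>
     (\<forall>c x. N (c *\<^sub>R x) = \<bar>c\<bar> * N x) \<and>
     (\<forall>x y. N (x + y) \<le> N x + N y)"

subsection \<open>Distribution functions, margins, copulas\<close>

definition univ_df :: "(real \<Rightarrow> real) \<Rightarrow> bool" where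
  "univ_df f \<longleftrightarrow> (\<exists>M. real_distribution M \<and> f = cdf M)"

definition multi_df :: "(real ^ 'n::finite \<Rightarrow> real) \<Rightarrow> bool" where
  "multi_df F \<longleftrightarrow>
     (\<exists>M. prob_space M \<and> sets M = sets borel \<and> F = (\<lambda>x. measure M {..x}))"

text \<open>The margin of a distribution function: all coordinates but the \<open>i\<close>-th tend to infinity.\<close>

definition margin :: "(real ^ 'n::finite \<Rightarrow> real) \<Rightarrow> 'n \<Rightarrow> real \<Rightarrow> real" where
  "margin F i t = Lim at_top (\<lambda>s. F (\<chi> j. if j = i then t else s))"

lemma tendsto_margin:
  fixes M :: "(real ^ 'n::finite) measure"
  assumes "prob_space M" and sets: "sets M = sets borel"
  shows "((\<lambda>s. measure M {..(\<chi> j. if j = i then t else s)})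
           \<longlongrightarrow> measure M {y. y $ i \<le> t}) at_top"
proof -
  interpret prob_space M by fact
  have m1: "{..(\<chi> j. if j = i then t else s)} \<in> sets M" for s :: real
    unfolding sets by (intro borel_closed closed_eucl_atMost)
  have m2: "{y. y $ i \<le> t} \<in> sets M"
    unfolding sets by (intro borel_closed closed_Collect_le continuous_intros)
  have "((\<lambda>s. integral\<^sup>L M (indicator {..(\<chi> j. if j = i then t else s)} :: _ \<Rightarrow> real))
          \<longlongrightarrow> integral\<^sup>L M (indicator {y. y $ i \<le> t})) at_top"
  proof (rule integral_dominated_convergence_at_top[where w = "\<lambda>_. 1"])
    show "AE y in M. ((\<lambda>s. indicator {..(\<chi> j. if j = i then t else s)} y :: real)
            \<longlongrightarrow> indicator {y. y $ i \<le> t} y) at_top"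
    proof (rule AE_I2)
      fix y :: "real ^ 'n"
      have "\<forall>\<^sub>F s in at_top. \<forall>j\<in>UNIV. y $ j \<le> s"
        by (intro eventually_ball_finite) (auto intro: eventually_ge_at_top)
      then have "\<forall>\<^sub>F s in at_top. indicator {..(\<chi> j. if j = i then t else s)} y
                   = (indicator {y. y $ i \<le> t} y :: real)"
        by eventually_elim (auto simp: indicator_def less_eq_vec_def)
      then show "((\<lambda>s. indicator {..(\<chi> j. if j = i then t else s)} y :: real)
            \<longlongrightarrow> indicator {y. y $ i \<le> t} y) at_top"
        by (rule tendsto_eventually)
    qed
  qed (use m1 m2 in \<open>auto simp: indicator_def\<close>)
  then show ?thesis
    using m1 m2 sets_eq_imp_space_eq[OF sets] by simp
qed

lemma margin_eq_measure:
  fixes M :: "(real ^ 'n::finite) measure"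
  assumes "prob_space M" and "sets M = sets borel"
  shows "margin (\<lambda>x. measure M {..x}) i t = measure M {y. y $ i \<le> t}"
  unfolding margin_def
  by (rule tendsto_Lim[OF _ tendsto_margin[OF assms]]) simp

text \<open>
  A distribution function on the unit cube is identified with the distribution function on the
  whole space whose measure is carried by the cube; with uniform margins this is automatic.
\<close>

definition copula :: "(real ^ 'n::finite \<Rightarrow> real) \<Rightarrow> bool" where
  "copula C \<longleftrightarrow> multi_df C \<and> (\<forall>i. \<forall>t\<in>{0..1}. margin C i t = t)"

definition copula_of :: "(real ^ 'n::finite \<Rightarrow> real) \<Rightarrow> (real ^ 'n \<Rightarrow> real) \<Rightarrow> bool" where
  "copula_of C F \<longleftrightarrow> copula C \<and> (\<forall>x. F x = C (\<chi> i. margin F i (x $ i)))"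

subsection \<open>Extreme value distributions and domains of attraction\<close>

definition nondegenerate :: "(real \<Rightarrow> real) \<Rightarrow> bool" where
  "nondegenerate f \<longleftrightarrow> \<not> (\<exists>c. \<forall>x. f x = (if c \<le> x then 1 else 0))"

definition univ_evd :: "(real \<Rightarrow> real) \<Rightarrow> bool" where
  "univ_evd g \<longleftrightarrow> univ_df g \<and> nondegenerate g \<and>
     (\<forall>n\<ge>1. \<exists>c>0. \<exists>d. \<forall>x. g (c * x + d) ^ n = g x)"

definition evd :: "(real ^ 'n::finite \<Rightarrow> real) \<Rightarrow> bool" where
  "evd G \<longleftrightarrow> multi_df G \<and> (\<forall>i. nondegenerate (margin G i)) \<and>
     (\<forall>n\<ge>1. \<exists>c d. (\<forall>i. 0 < c $ i) \<and> (\<forall>x. G (c * x + d) ^ n = G x))"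

definition univ_domain_of_attraction :: "(real \<Rightarrow> real) \<Rightarrow> (real \<Rightarrow> real) \<Rightarrow> bool" where
  "univ_domain_of_attraction f g \<longleftrightarrow>
     (\<exists>a b. (\<forall>n. 0 < a n) \<and> (\<forall>x. (\<lambda>n. f (a n * x + b n) ^ n) \<longlonglongrightarrow> g x))"

definition domain_of_attraction ::
    "(real ^ 'n::finite \<Rightarrow> real) \<Rightarrow> (real ^ 'n \<Rightarrow> real) \<Rightarrow> bool" where
  "domain_of_attraction F G \<longleftrightarrow>
     (\<exists>a b. (\<forall>n i. 0 < a n $ i) \<and> (\<forall>x. (\<lambda>n. F (a n * x + b n) ^ n) \<longlonglongrightarrow> G x))"

subsection \<open>Generalized Pareto distributions\<close>

text \<open>\<open>0 < G x\<close> is required because of the library convention \<open>ln 0 = 0\<close>.\<close>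

definition gp_tail :: "(real ^ 'n::finite \<Rightarrow> real) \<Rightarrow> (real ^ 'n \<Rightarrow> real) \<Rightarrow> (real ^ 'n) set \<Rightarrow> bool" where
  "gp_tail W G S \<longleftrightarrow> (\<forall>x\<in>S. 0 < G x \<and> W x = 1 + ln (G x))"

definition gpd :: "(real ^ 'n::finite \<Rightarrow> real) \<Rightarrow> bool" where
  "gpd W \<longleftrightarrow> multi_df W \<and> (\<exists>G x0. evd G \<and> G x0 < 1 \<and> gp_tail W G {x0..})"

text \<open>
  For ultimately uniform margins the point \<open>x0\<close> of the tail representation has to be strictly
  negative in every component and \<open>G\<close> has standard negative exponential margins.
  A representation on some upper orthant \<open>{x0..}\<close> alone would not suffice: it says nothing about
  \<open>W\<close> near the origin if a component of \<open>x0\<close> is nonnegative.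
\<close>

definition gpd_ultimately_uniform :: "(real ^ 'n::finite \<Rightarrow> real) \<Rightarrow> bool" where
  "gpd_ultimately_uniform W \<longleftrightarrow> gpd W \<and>
     (\<exists>x0. (\<forall>i. x0 $ i < 0) \<and>
        (\<forall>i. \<forall>t\<in>{x0 $ i..0}. margin W i t = 1 + t) \<and>
        (\<exists>G. evd G \<and> (\<forall>i. \<forall>t\<le>0. margin G i t = exp t) \<and> gp_tail W G {x0..0}))"

end

theory Submission
  imports Defs
begin

text \<open>
  Write \<open>E v\<close> for the limit of \<open>C (1 - v / n) ^ n\<close>, \<open>v \<ge> 0\<close>. Since \<open>C\<close> is Lipschitz, the limit may be
  taken along the margins \<open>F\<^sub>i (a\<^sub>n x + b\<^sub>n)\<close>, so that \<open>F\<close> is attracted by an extreme value distribution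
  iff its margins are and \<open>E (- y)\<close> exists as an extreme value distribution with negative
  exponential margins; and the existence of \<open>E\<close> amounts to \<open>C y = 1 + ln (E (1 - y)) + o(|y - 1|)\<close>, by
  homogeneity of \<open>ln E\<close>. No classification of the univariate limits is needed: max-stability alone
  makes the range of a univariate extreme value distribution dense in the unit interval.

  It remains to find a distribution function that equals \<open>1 + ln G\<close> near the origin, where
  \<open>G y = E (- y)\<close>. It is a weak limit of uniformly bounded random vectors, and a space-filling curve
  with a Borel section reduces its existence to Helly's theorem on the real line.
\<close>

section \<open>Distribution functions and their margins\<close>

text \<open>The natural scale is \<open>n * (1 - p)\<close>: for numbers in the unit interval,
  \<open>p ^ n\<close> moves by at most \<open>n\<close> times the change of \<open>p\<close>, and a
  copula is Lipschitz in the l1 distance. An error of order o(1/n) in the argument of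
  \<open>C\<close> is therefore invisible in the \<open>n\<close>-th power, which lets margins and
  dependence be treated apart.

  Three obstacles shape the rest. Margins of an extreme value distribution are not known to be
  continuous; density of their range takes the place of continuity, both in the integral transform
  to exponential margins and in approximating every \<open>v\<close> by vectors
  \<open>- ln (g x)\<close>. Max-stability speaks of integers only, so \<open>ln G\<close> is scaled
  by reciprocals of integers; Lipschitz bounds and compactness turn this into an expansion uniform
  near 1. Finally, \<open>1 + ln G\<close> has to give nonnegative mass to every box near the
  origin, which monotonicity alone does not provide; a limit of probability laws has this property
  by construction.\<close>

lemma sets_atMost_vec [measurable]: "{..x :: real ^ 'n::finite} \<in> sets borel"
  by (intro borel_closed closed_eucl_atMost)

lemma multi_dfE:
  fixes F :: "real ^ 'n::finite \<Rightarrow> real"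
  assumes "multi_df F"
  obtains M where "prob_space M" "sets M = sets borel" "\<And>x. F x = measure M {..x}"
    "\<And>i t. margin F i t = measure M {y. y $ i \<le> t}"
  using assms margin_eq_measure unfolding multi_df_def by blast

lemma measure_Collect_le_nth:
  fixes M :: "(real ^ 'n::finite) measure"
  assumes "sets M = sets borel"
  shows "{y. y $ i \<le> t} \<in> sets M" "{y. t < y $ i} \<in> sets M" "{..x} \<in> sets M"
    "space M = UNIV"
  unfolding assms sets_eq_imp_space_eq[OF assms]
  by (auto intro!: borel_closed borel_open closed_Collect_le open_Collect_less continuous_intros
      closed_eucl_atMost)

lemma univ_df_margin:
  fixes F :: "real ^ 'n::finite \<Rightarrow> real"
  assumes "multi_df F"
  shows "univ_df (margin F i)"
proof -
  obtain M where M: "prob_space M" and sets: "sets M = sets borel"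
    and F: "\<And>i t. margin F i t = measure M {y. y $ i \<le> t}"
    using multi_dfE[OF assms] by metis
  interpret prob_space M by fact
  have m: "(\<lambda>y. y $ i) \<in> borel_measurable M"
    using sets by (simp cong: measurable_cong_sets)
  have "margin F i = cdf (distr M borel (\<lambda>y. y $ i))"
    using measure_Collect_le_nth(4)[OF sets]
    by (auto simp: F cdf_def measure_distr[OF m] vimage_def)
  then show ?thesis
    unfolding univ_df_def using m by blast
qed

lemma
  assumes "univ_df f"
  shows univ_df_mono: "x \<le> y \<Longrightarrow> f x \<le> f y"
    and univ_df_nonneg: "0 \<le> f x"
    and univ_df_le_1: "f x \<le> 1"
    and univ_df_at_top: "(f \<longlongrightarrow> 1) at_top"
    and univ_df_at_bot: "(f \<longlongrightarrow> 0) at_bot"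
    and univ_df_right_cont: "continuous (at_right x) f"
proof -
  obtain M where "real_distribution M" and f: "f = cdf M"
    using assms unfolding univ_df_def by auto
  then interpret real_distribution M by simp
  show "x \<le> y \<Longrightarrow> f x \<le> f y" "0 \<le> f x" "f x \<le> 1" "(f \<longlongrightarrow> 1) at_top" "(f \<longlongrightarrow> 0) at_bot"
    "continuous (at_right x) f"
    unfolding f using cdf_nondecreasing cdf_nonneg cdf_bounded_prob cdf_lim_at_top_prob
      cdf_lim_at_bot cdf_is_right_cont by auto
qed

text \<open>The inequalities between \<open>F\<close> and its margins are union bounds. A point
  below \<open>x\<close> in coordinate \<open>i\<close> that misses \<open>{..x}\<close> exceeds
  \<open>x\<close> in another coordinate, and \<open>{..x} - {..y}\<close> is covered by the slabs
  between \<open>y $ j\<close> and \<open>x $ j\<close>, whose masses are differences of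
  margins.\<close>

lemma
  fixes F :: "real ^ 'n::finite \<Rightarrow> real"
  assumes "multi_df F"
  shows multi_df_nonneg: "0 \<le> F x"
    and multi_df_le_1: "F x \<le> 1"
    and multi_df_le_margin: "F x \<le> margin F i (x $ i)"
    and margin_minus_multi_df: "margin F i (x $ i) - F x \<le> (\<Sum>j\<in>UNIV - {i}. 1 - margin F j (x $ j))"
    and multi_df_Lipschitz: "\<bar>F x - F y\<bar> \<le> (\<Sum>i\<in>UNIV. \<bar>margin F i (x $ i) - margin F i (y $ i)\<bar>)"
    and tendsto_margin': "((\<lambda>s. F (\<chi> j. if j = i then t else s)) \<longlongrightarrow> margin F i t) at_top"
proof -
  obtain M where M: "prob_space M" and sets: "sets M = sets borel"
    and F: "\<And>x. F x = measure M {..x}" "\<And>i t. margin F i t = measure M {y. y $ i \<le> t}"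
    using multi_dfE[OF assms] by metis
  interpret prob_space M by fact
  note meas = measure_Collect_le_nth[OF sets]
  note [simp] = meas(1-3)
  show "0 \<le> F x" "F x \<le> 1"
    unfolding F by auto
  show "F x \<le> margin F i (x $ i)" for i
    unfolding F by (intro finite_measure_mono) (auto simp: less_eq_vec_def)
  show "((\<lambda>s. F (\<chi> j. if j = i then t else s)) \<longlongrightarrow> margin F i t) at_top"
    unfolding F using tendsto_margin[OF M sets] .
  have compl: "prob {y. t < y $ j} = 1 - margin F j t" for t j
  proof -
    have "{y. t < y $ j} = space M - {y. y $ j \<le> t}"
      using meas(4) by auto
    then show ?thesis
      unfolding F using prob_compl[OF meas(1)] by simp
  qed
  have "prob {y. y $ i \<le> x $ i} \<le> prob ({..x} \<union> (\<Union>j\<in>UNIV - {i}. {y. x $ j < y $ j}))"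
    by (intro finite_measure_mono sets.Un sets.finite_UN)
      (auto simp: less_eq_vec_def, metis DiffI UNIV_I emptyE insert_iff not_le)
  also have "\<dots> \<le> prob {..x} + prob (\<Union>j\<in>UNIV - {i}. {y. x $ j < y $ j})"
    by (intro measure_Un_le sets.finite_UN) auto
  also have "prob (\<Union>j\<in>UNIV - {i}. {y. x $ j < y $ j}) \<le> (\<Sum>j\<in>UNIV - {i}. prob {y. x $ j < y $ j})"
    by (intro finite_measure_subadditive_finite) auto
  finally show "margin F i (x $ i) - F x \<le> (\<Sum>j\<in>UNIV - {i}. 1 - margin F j (x $ j))"
    unfolding compl by (simp add: F)
  have *: "F x - F y \<le> (\<Sum>i\<in>UNIV. \<bar>margin F i (x $ i) - margin F i (y $ i)\<bar>)" for x y
  proof -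
    have "prob {..x} \<le> prob ({..y} \<union> (\<Union>j. {z. z $ j \<le> x $ j} - {z. z $ j \<le> y $ j}))"
      by (intro finite_measure_mono sets.Un sets.finite_UN sets.Diff) (auto simp: less_eq_vec_def)
    also have "\<dots> \<le> prob {..y} + prob (\<Union>j. {z. z $ j \<le> x $ j} - {z. z $ j \<le> y $ j})"
      by (intro measure_Un_le sets.finite_UN sets.Diff) auto
    also have "prob (\<Union>j. {z. z $ j \<le> x $ j} - {z. z $ j \<le> y $ j})
        \<le> (\<Sum>j\<in>UNIV. prob ({z. z $ j \<le> x $ j} - {z. z $ j \<le> y $ j}))"
      by (intro finite_measure_subadditive_finite) auto
    also have "\<dots> \<le> (\<Sum>j\<in>UNIV. \<bar>margin F j (x $ j) - margin F j (y $ j)\<bar>)"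
    proof (intro sum_mono)
      fix j
      show "prob ({z. z $ j \<le> x $ j} - {z. z $ j \<le> y $ j}) \<le> \<bar>margin F j (x $ j) - margin F j (y $ j)\<bar>"
      proof (cases "x $ j \<le> y $ j")
        case True
        then have empty: "{z. z $ j \<le> x $ j} - {z. z $ j \<le> y $ j} = {}"
          by auto
        show ?thesis unfolding empty by simp
      next
        case False
        then show ?thesis
          unfolding F by (subst finite_measure_Diff) auto
      qed
    qed
    finally show ?thesis
      unfolding F by simp
  qed
  show "\<bar>F x - F y\<bar> \<le> (\<Sum>i\<in>UNIV. \<bar>margin F i (x $ i) - margin F i (y $ i)\<bar>)"
    using *[of x y] *[of y x] by (simp add: abs_le_iff abs_minus_commute)
qed

lemma one_minus_multi_df_le:
  fixes F :: "real ^ 'n::finite \<Rightarrow> real"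
  assumes "multi_df F"
  shows "1 - F x \<le> (\<Sum>j\<in>UNIV. 1 - margin F j (x $ j))"
  \<comment> \<open>\<open>undefined\<close> is just some coordinate; its own term completes the
    sum.\<close>
  using margin_minus_multi_df[OF assms, of undefined x] by (simp add: sum_diff1)

lemma multi_df_diagonal_at_top:
  fixes F :: "real ^ 'n::finite \<Rightarrow> real"
  assumes "multi_df F"
  shows "((\<lambda>s. F (\<chi> j. s)) \<longlongrightarrow> 1) at_top"
proof (rule tendsto_sandwich)
  show "\<forall>\<^sub>F s in at_top. 1 - (\<Sum>j\<in>UNIV. 1 - margin F j s) \<le> F (\<chi> j. s)"
    using one_minus_multi_df_le[OF assms, of "\<chi> j. s" for s]
    by (intro always_eventually allI) (simp add: algebra_simps)
  have "((\<lambda>s. 1 - (\<Sum>j\<in>UNIV. 1 - margin F j s)) \<longlongrightarrow> 1 - (\<Sum>j\<in>(UNIV::'n set). 1 - 1)) at_top"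
    by (intro tendsto_intros univ_df_at_top univ_df_margin assms)
  then show "((\<lambda>s. 1 - (\<Sum>j\<in>UNIV. 1 - margin F j s)) \<longlongrightarrow> 1) at_top"
    by simp
qed (use multi_df_le_1[OF assms] in auto)

section \<open>Powers of numbers close to one\<close>

lemma abs_power_diff_le:
  fixes a b :: real
  assumes "0 \<le> a" "a \<le> 1" "0 \<le> b" "b \<le> 1"
  shows "\<bar>a ^ n - b ^ n\<bar> \<le> n * \<bar>a - b\<bar>"
  using norm_power_diff[of a b n] assms by simp

text \<open>Comparison with \<open>(1 - h / n) ^ n\<close>: the \<open>n\<close>-th powers differ by
  at most \<open>n\<close> times the difference of the bases, which is
  \<open>\<bar>n * (1 - p n) - h\<bar>\<close>.\<close>

lemma tendsto_power_exp:
  fixes p :: "nat \<Rightarrow> real"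
  assumes p: "\<And>n. 0 \<le> p n" "\<And>n. p n \<le> 1" and h: "(\<lambda>n. n * (1 - p n)) \<longlonglongrightarrow> h"
  shows "(\<lambda>n. p n ^ n) \<longlonglongrightarrow> exp (- h)"
proof -
  have h0: "0 \<le> h"
    using p(2) by (intro LIMSEQ_le_const[OF h]) auto
  have "(\<lambda>n. p n ^ n - (1 + - h / n) ^ n) \<longlonglongrightarrow> 0"
  proof (rule Lim_null_comparison)
    have "(\<lambda>n. n * (1 - p n) - h) \<longlonglongrightarrow> h - h"
      by (intro tendsto_intros h)
    then show "(\<lambda>n. \<bar>n * (1 - p n) - h\<bar>) \<longlonglongrightarrow> 0"
      using tendsto_rabs_zero by fastforce
    show "\<forall>\<^sub>F n in sequentially. norm (p n ^ n - (1 + - h / n) ^ n) \<le> \<bar>n * (1 - p n) - h\<bar>"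
      \<comment> \<open>From here on \<open>1 - h / n\<close> lies in the unit interval, as the
        comparison of powers requires.\<close>
      using eventually_ge_at_top[of "nat \<lceil>h\<rceil> + 1"]
    proof eventually_elim
      case (elim n)
      then have n: "real n \<ge> h" "n > 0" by linarith+
      then have "norm (p n ^ n - (1 + - h / n) ^ n) \<le> n * \<bar>p n - (1 + - h / n)\<bar>"
        using p h0 abs_power_diff_le[of "p n" "1 + - h / n" n] by (simp add: field_simps)
      also have "\<dots> = \<bar>n * (p n - (1 + - h / n))\<bar>"
        by (simp add: abs_mult)
      also have "n * (p n - (1 + - h / n)) = - (n * (1 - p n) - h)"
        using n by (simp add: field_simps)
      finally show ?case by simp
    qed
  qed
  from tendsto_add[OF this tendsto_exp_limit_sequentially[of "- h"]] show ?thesis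
    by simp
qed

text \<open>Positivity of \<open>g\<close> keeps \<open>n * ln (p n)\<close> bounded, so
  \<open>p n\<close> tends to 1. Then \<open>1 - p\<close> lies between \<open>- p * ln p\<close>
  and \<open>- ln p\<close>, and \<open>n\<close> times either bound tends to
  \<open>- ln g\<close>.\<close>

lemma tendsto_exp_power:
  fixes p :: "nat \<Rightarrow> real"
  assumes p: "\<And>n. 0 \<le> p n" "\<And>n. p n \<le> 1" and g: "(\<lambda>n. p n ^ n) \<longlonglongrightarrow> g" "0 < g"
  shows "(\<lambda>n. n * (1 - p n)) \<longlonglongrightarrow> - ln g"
proof -
  have pos: "\<forall>\<^sub>F n in sequentially. 0 < p n \<and> 0 < n"
    using order_tendstoD(1)[OF g] eventually_gt_at_top[of 0]
  proof eventually_elim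
    case (elim n)
    then show ?case
      using p(1)[of n] by (cases "p n = 0") (auto simp: zero_power)
  qed
  have L: "(\<lambda>n. n * ln (p n)) \<longlonglongrightarrow> ln g"
  proof (rule Lim_transform_eventually[OF tendsto_ln[OF g(1)]])
    show "\<forall>\<^sub>F n in sequentially. ln (p n ^ n) = n * ln (p n)"
      using pos by eventually_elim (simp add: ln_realpow)
  qed (use g in auto)
  have "(\<lambda>n. ln (p n)) \<longlonglongrightarrow> 0"
  proof (rule Lim_transform_eventually)
    show "(\<lambda>n. (n * ln (p n)) * inverse (real n)) \<longlonglongrightarrow> 0"
      using tendsto_mult[OF L LIMSEQ_inverse_real_of_nat[THEN LIMSEQ_imp_Suc]] by simp
    show "\<forall>\<^sub>F n in sequentially. (n * ln (p n)) * inverse (real n) = ln (p n)"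
      using pos by eventually_elim simp
  qed
  then have "(\<lambda>n. exp (ln (p n))) \<longlonglongrightarrow> exp 0"
    by (rule tendsto_exp)
  then have p1: "p \<longlonglongrightarrow> 1"
    using pos by (simp, elim Lim_transform_eventually) (auto elim: eventually_mono)
  show ?thesis
  proof (rule tendsto_sandwich)
    show "\<forall>\<^sub>F n in sequentially. p n * - (n * ln (p n)) \<le> n * (1 - p n)"
      using pos
    proof eventually_elim
      case (elim n)
      then have "- ln (p n) \<le> inverse (p n) - 1"
        using ln_add_one_self_le_self2[of "inverse (p n) - 1"] by (simp add: ln_inverse)
      then have "p n * - ln (p n) \<le> p n * (inverse (p n) - 1)"
        using elim by (intro mult_left_mono) auto
      also have "\<dots> = 1 - p n"
        using elim by (simp add: field_simps)
      finally have "real n * (p n * - ln (p n)) \<le> n * (1 - p n)"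
        by (intro mult_left_mono) auto
      then show ?case
        by (simp add: mult_ac)
    qed
    show "\<forall>\<^sub>F n in sequentially. n * (1 - p n) \<le> - (n * ln (p n))"
      using pos
    proof eventually_elim
      case (elim n)
      then have "1 - p n \<le> - ln (p n)"
        using ln_le_minus_one[of "p n"] by simp
      then have "real n * (1 - p n) \<le> n * - ln (p n)"
        by (intro mult_left_mono) auto
      then show ?case by simp
    qed
    show "(\<lambda>n. p n * - (n * ln (p n))) \<longlonglongrightarrow> - ln g"
      using tendsto_mult[OF p1 tendsto_minus[OF L]] by simp
  qed (rule tendsto_minus[OF L])
qed

section \<open>A space-filling curve with a Borel section\<close>

definition binary_digit :: "real \<Rightarrow> nat \<Rightarrow> real" where
  "binary_digit x k = real_of_int (\<lfloor>2 ^ Suc k * x\<rfloor> mod 2)"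

lemma binary_digit_cases: "binary_digit x k = 0 \<or> binary_digit x k = 1"
  unfolding binary_digit_def by (auto simp: mod_2_eq_odd)

lemma binary_digit_sums:
  assumes "0 \<le> x" "x < 1"
  shows "(\<lambda>k. binary_digit x k / 2 ^ Suc k) sums x"
proof -
  \<comment> \<open>The partial sum truncates \<open>x\<close> after \<open>K\<close> binary digits.
    The case \<open>K = 0\<close> needs a vanishing integer part, hence the half-open
    interval.\<close>
  have partial: "(\<Sum>k<K. binary_digit x k / 2 ^ Suc k) = \<lfloor>2 ^ K * x\<rfloor> / 2 ^ K" for K
  proof (induction K)
    case 0
    then show ?case using assms by (simp add: floor_eq_iff)
  next
    case (Suc K)
    have "\<lfloor>2 ^ K * x\<rfloor> = \<lfloor>2 ^ Suc K * x / real_of_int 2\<rfloor>"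
      by simp
    also have "\<dots> = \<lfloor>2 ^ Suc K * x\<rfloor> div 2"
      by (rule floor_divide_real_eq_div) simp
    finally have "\<lfloor>2 ^ Suc K * x\<rfloor> = 2 * \<lfloor>2 ^ K * x\<rfloor> + \<lfloor>2 ^ Suc K * x\<rfloor> mod 2"
      by simp
    then have "real_of_int \<lfloor>2 ^ Suc K * x\<rfloor> = 2 * real_of_int \<lfloor>2 ^ K * x\<rfloor> + binary_digit x K"
      unfolding binary_digit_def by linarith
    then show ?case
      using Suc by (simp add: field_simps)
  qed
  have "(\<lambda>K. \<lfloor>2 ^ K * x\<rfloor> / 2 ^ K - x) \<longlonglongrightarrow> 0"
  proof (rule Lim_null_comparison)
    show "(\<lambda>K. (1 / 2 :: real) ^ K) \<longlonglongrightarrow> 0"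
      by (intro LIMSEQ_realpow_zero) auto
    show "\<forall>\<^sub>F K in sequentially. norm (\<lfloor>2 ^ K * x\<rfloor> / 2 ^ K - x) \<le> (1 / 2) ^ K"
    proof (intro always_eventually allI)
      fix K :: nat
      have "norm (\<lfloor>2 ^ K * x\<rfloor> / 2 ^ K - x) = \<bar>\<lfloor>2 ^ K * x\<rfloor> - 2 ^ K * x\<bar> / 2 ^ K"
        by (simp add: field_simps abs_divide flip: abs_mult)
      also have "\<dots> \<le> 1 / 2 ^ K"
        by (intro divide_right_mono) (auto simp: abs_le_iff, linarith+)
      finally show "norm (\<lfloor>2 ^ K * x\<rfloor> / 2 ^ K - x) \<le> (1 / 2) ^ K"
        by (simp add: power_one_over)
    qed
  qed
  then show ?thesis
    unfolding sums_def partial using Lim_null by blast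
qed

text \<open>A continuous even function of period 2 that is 0 on \<open>{0..1/3}\<close> and 1 on
  \<open>{2/3..1}\<close>: the cosine equals 1/2 at pi/3 and -1/2 at 2pi/3, and the rest is
  clipped.\<close>

definition bump :: "real \<Rightarrow> real" where
  "bump t = max 0 (min 1 (1 / 2 - cos (pi * t)))"

text \<open>
  Modulo 2, the number \<open>3 ^ l * t\<close> lies in \<open>{0..1/3}\<close> or in \<open>{2/3..1}\<close>, according to the
  \<open>l\<close>-th digit of the point \<open>t\<close> of the Cantor set. This is Schoenberg's construction.
\<close>

lemma bump_ternary:
  assumes b: "\<And>k. b k = 0 \<or> b k = (1::real)"
  shows "summable (\<lambda>k. 2 * b k / 3 ^ Suc k)"
    and "0 \<le> (\<Sum>k. 2 * b k / 3 ^ Suc k)" "(\<Sum>k. 2 * b k / 3 ^ Suc k) \<le> 1"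
    and "bump (3 ^ l * (\<Sum>k. 2 * b k / 3 ^ Suc k)) = b l"
proof -
  have geo: "(\<lambda>k. 2 / 3 ^ Suc k :: real) sums 1"
    using sums_mult[OF geometric_sums[of "1 / 3 :: real"], of "2 / 3"]
    by (simp add: field_simps power_one_over)
  have *: "summable (\<lambda>k. 2 * c k / 3 ^ Suc k) \<and> 0 \<le> (\<Sum>k. 2 * c k / 3 ^ Suc k)
      \<and> (\<Sum>k. 2 * c k / 3 ^ Suc k) \<le> 1"
    if c: "\<And>k. c k = 0 \<or> c k = (1::real)" for c
  proof -
    have c': "0 \<le> c k" "c k \<le> 1" for k
      using c[of k] by auto
    have s: "summable (\<lambda>k. 2 * c k / 3 ^ Suc k)"
      using c' by (intro summable_comparison_test'[OF sums_summable[OF geo], of 0])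
        (auto simp: divide_right_mono)
    moreover have "(\<Sum>k. 2 * c k / 3 ^ Suc k) \<le> (\<Sum>k. 2 / 3 ^ Suc k)"
      using c' by (intro suminf_le s sums_summable[OF geo]) (auto intro!: divide_right_mono)
    ultimately show ?thesis
      using sums_unique[OF geo] c' by (auto intro!: suminf_nonneg)
  qed
  show s: "summable (\<lambda>k. 2 * b k / 3 ^ Suc k)"
    and "0 \<le> (\<Sum>k. 2 * b k / 3 ^ Suc k)" "(\<Sum>k. 2 * b k / 3 ^ Suc k) \<le> 1"
    using *[of b] b by auto
  \<comment> \<open>The digits before position \<open>l\<close> contribute an even integer, that is,
    whole periods of \<open>bump\<close>.\<close>
  have "\<exists>m::int. 3 ^ l * (\<Sum>k<l. 2 * b k / 3 ^ Suc k) = 2 * real_of_int m" for l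
  proof (induction l)
    case 0
    show ?case by (intro exI[of _ 0]) simp
  next
    case (Suc l)
    then obtain m :: int where "3 ^ l * (\<Sum>k<l. 2 * b k / 3 ^ Suc k) = 2 * real_of_int m"
      by blast
    moreover obtain d :: int where "b l = d"
      using b[of l] by (metis of_int_0 of_int_1)
    ultimately show ?case
      by (intro exI[of _ "3 * m + d"]) (simp add: field_simps)
  qed
  then obtain m :: int where m: "3 ^ l * (\<Sum>k<l. 2 * b k / 3 ^ Suc k) = 2 * real_of_int m"
    by blast
  \<comment> \<open>The digits after position \<open>l\<close> contribute at most 1/3, which is
    exactly the room that the flat pieces of \<open>bump\<close> leave.\<close>
  define r where "r = (\<Sum>k. 2 * b (Suc k + l) / 3 ^ Suc k) / 3"
  have r: "0 \<le> r" "r \<le> 1 / 3"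
    unfolding r_def using *[of "\<lambda>k. b (Suc k + l)"] b by auto
  have "(\<Sum>k. 2 * b k / 3 ^ Suc k) = (\<Sum>k. 2 * b (k + l) / 3 ^ Suc (k + l)) + (\<Sum>k<l. 2 * b k / 3 ^ Suc k)"
    by (rule suminf_split_initial_segment[OF s])
  also have "(\<Sum>k. 2 * b (k + l) / 3 ^ Suc (k + l)) = (\<Sum>k. 1 / 3 ^ l * (2 * b (k + l) / 3 ^ Suc k))"
    by (simp add: power_add mult_ac)
  also have "\<dots> = 1 / 3 ^ l * (\<Sum>k. 2 * b (k + l) / 3 ^ Suc k)"
    using *[of "\<lambda>k. b (k + l)"] b by (intro suminf_mult) auto
  also have "(\<Sum>k. 2 * b (k + l) / 3 ^ Suc k) = 2 * b l / 3 + (\<Sum>k. 2 * b (Suc k + l) / 3 ^ Suc (Suc k))"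
    using suminf_split_head[of "\<lambda>k. 2 * b (k + l) / 3 ^ Suc k"] *[of "\<lambda>k. b (k + l)"] b by simp
  also have "(\<Sum>k. 2 * b (Suc k + l) / 3 ^ Suc (Suc k)) = (\<Sum>k. 1 / 3 * (2 * b (Suc k + l) / 3 ^ Suc k))"
    by (simp add: mult_ac)
  also have "\<dots> = r"
    unfolding r_def using *[of "\<lambda>k. b (Suc k + l)"] b by (subst suminf_mult) auto
  finally have "3 ^ l * (\<Sum>k. 2 * b k / 3 ^ Suc k)
      = (2 * b l / 3 + r) + 3 ^ l * (\<Sum>k<l. 2 * b k / 3 ^ Suc k)"
    by (simp add: algebra_simps)
  then have eq: "3 ^ l * (\<Sum>k. 2 * b k / 3 ^ Suc k) = (2 * b l / 3 + r) + 2 * m"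
    unfolding m by simp
  have "cos (pi * ((2 * b l / 3 + r) + 2 * m)) = cos (pi * (2 * b l / 3 + r) + 2 * pi * of_int m)"
    by (simp add: algebra_simps)
  also have "\<dots> = cos (pi * (2 * b l / 3 + r))"
    by (simp add: cos_add)
  finally have cos: "cos (pi * (3 ^ l * (\<Sum>k. 2 * b k / 3 ^ Suc k))) = cos (pi * (2 * b l / 3 + r))"
    unfolding eq .
  show "bump (3 ^ l * (\<Sum>k. 2 * b k / 3 ^ Suc k)) = b l"
  proof (cases "b l = 0")
    case True
    have "cos (pi / 3) \<le> cos (pi * r)"
      using r by (intro cos_monotone_0_pi_le) auto
    then show ?thesis
      using True unfolding bump_def cos by (simp add: cos_60)
  next
    case False
    then have 1: "b l = 1" using b[of l] by auto
    have "cos (pi * (2 / 3 + r)) \<le> cos (2 * pi / 3)"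
      using r mult_left_mono[of "2 / 3 + r" 1 pi] by (intro cos_monotone_0_pi_le) auto
    then show ?thesis
      using 1 unfolding bump_def cos by (simp add: cos_120)
  qed
qed

text \<open>\<open>to_nat (j, k)\<close> is the ternary position that stores binary digit
  \<open>k\<close> of coordinate \<open>j\<close>, so all coordinates share one expansion.\<close>

definition cube_curve :: "real \<Rightarrow> real ^ 'n::finite" where
  "cube_curve t = (\<chi> j. \<Sum>k. bump (3 ^ to_nat (j, k) * t) / 2 ^ Suc k)"

text \<open>A point of the Cantor set, since its ternary digits are 0 and 2. A position outside the
  range of \<open>to_nat\<close> holds a digit of an arbitrary pair, which the curve never consults
  on coded points.\<close>

definition cube_code :: "real ^ 'n::finite \<Rightarrow> real" where
  "cube_code x = (\<Sum>l. 2 * (case from_nat l of (j, k) \<Rightarrow> binary_digit (x $ j) k) / 3 ^ Suc l)"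

lemma digit_family: "(case p of (j, k) \<Rightarrow> binary_digit (x $ j) k) = 0 \<or>
    (case p of (j, k) \<Rightarrow> binary_digit (x $ j) k) = 1"
  using binary_digit_cases by (cases p) auto

lemma cube_code_bounds: "0 \<le> cube_code x" "cube_code x \<le> 1"
  unfolding cube_code_def by (rule bump_ternary; rule digit_family)+

lemma cube_curve_code:
  fixes x :: "real ^ 'n::finite"
  assumes "\<And>i. 0 \<le> x $ i" "\<And>i. x $ i < 1"
  shows "cube_curve (cube_code x) = x"
proof -
  have "bump (3 ^ to_nat (j, k) * cube_code x) = binary_digit (x $ j) k" for j k
    unfolding cube_code_def
    by (subst bump_ternary(4)[OF digit_family]) simp
  then show ?thesis
    unfolding cube_curve_def vec_eq_iff
    using binary_digit_sums[OF assms] by (auto intro!: sums_unique[symmetric])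
qed

lemma continuous_cube_curve: "continuous_on UNIV (cube_curve :: real \<Rightarrow> real ^ 'n::finite)"
proof -
  have "continuous_on UNIV (\<lambda>t. \<Sum>k. bump (3 ^ to_nat (j, k) * t) / 2 ^ Suc k)" for j :: 'n
  proof (rule uniform_limit_theorem)
    show "uniform_limit UNIV (\<lambda>n t. \<Sum>k<n. bump (3 ^ to_nat (j, k) * t) / 2 ^ Suc k)
        (\<lambda>t. \<Sum>k. bump (3 ^ to_nat (j, k) * t) / 2 ^ Suc k) sequentially"
    proof (rule Weierstrass_m_test)
      show "summable (\<lambda>k. (1 / 2 :: real) ^ Suc k)"
        unfolding power_Suc by (intro summable_mult summable_geometric) simp
      show "norm (bump (3 ^ to_nat (j, k) * t) / 2 ^ Suc k) \<le> (1 / 2) ^ Suc k" for k t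
        unfolding bump_def by (auto simp: power_one_over intro!: divide_right_mono)
    qed
    show "\<forall>\<^sub>F n in sequentially. continuous_on UNIV (\<lambda>t. \<Sum>k<n. bump (3 ^ to_nat (j, k) * t) / 2 ^ Suc k)"
      unfolding bump_def by (intro always_eventually allI continuous_intros) auto
  qed simp
  then show ?thesis
    unfolding cube_curve_def by (intro continuous_on_vec_lambda)
qed

lemma borel_measurable_cube_code [measurable]:
  "(cube_code :: real ^ 'n::finite \<Rightarrow> real) \<in> borel_measurable borel"
proof -
  have "(\<lambda>x :: real ^ 'n. case p of (j, k) \<Rightarrow> binary_digit (x $ j) k) \<in> borel_measurable borel" for p
    unfolding binary_digit_def by (cases p) (simp, measurable)
  then show ?thesis
    unfolding cube_code_def by measurable
qed

section \<open>Weak limits of uniformly bounded random vectors\<close>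

text \<open>The laws are pushed to a bounded interval by the section \<open>s\<close>, and the limit
  is pushed back by the curve \<open>\<phi>\<close>. Test functions are composed with
  \<open>\<phi>\<close> only, which is continuous; \<open>s\<close> merely transports measures, so
  Borel measurability is enough for it. The identity \<open>\<phi> (s x) = x\<close> keeps the
  integrals unchanged.\<close>

lemma bounded_weak_limit:
  fixes \<mu> :: "nat \<Rightarrow> (real ^ 'n::finite) measure"
  assumes prob: "\<And>n. prob_space (\<mu> n)" and sets: "\<And>n. sets (\<mu> n) = sets borel"
    and L: "0 < L" "\<And>n. AE x in \<mu> n. \<forall>i. \<bar>x $ i\<bar> < L"
  shows "\<exists>\<nu> r. prob_space \<nu> \<and> sets \<nu> = sets borel \<and> strict_mono (r :: nat \<Rightarrow> nat) \<and>
    (\<forall>(f :: real ^ 'n \<Rightarrow> real) B. continuous_on UNIV f \<longrightarrow> (\<forall>x. \<bar>f x\<bar> \<le> B) \<longrightarrow>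
      (\<lambda>n. integral\<^sup>L (\<mu> (r n)) f) \<longlonglongrightarrow> integral\<^sup>L \<nu> f)"
proof -
  define \<phi> :: "real \<Rightarrow> real ^ 'n" where "\<phi> t = (\<chi> j. 2 * L * cube_curve t $ j - L)" for t
  define s :: "real ^ 'n \<Rightarrow> real" where "s x = cube_code (\<chi> i. (x $ i + L) / (2 * L))" for x
  have s_meas: "s \<in> borel_measurable borel"
  proof -
    have "(\<lambda>x :: real ^ 'n. \<chi> i. (x $ i + L) / (2 * L)) \<in> borel_measurable borel"
      by (intro borel_measurable_continuous_onI continuous_on_vec_lambda continuous_intros) (use L in auto)
    then show ?thesis
      unfolding s_def by measurable
  qed
  have \<phi>_cont: "continuous_on UNIV \<phi>"
    unfolding \<phi>_def
    by (intro continuous_on_vec_lambda continuous_intros continuous_on_component continuous_cube_curve)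
  then have \<phi>_meas: "\<phi> \<in> borel_measurable borel"
    by (rule borel_measurable_continuous_onI)
  have \<phi>s: "\<phi> (s x) = x" if "\<forall>i. \<bar>x $ i\<bar> < L" for x
  proof -
    have "cube_curve (s x) = (\<chi> i. (x $ i + L) / (2 * L))"
      unfolding s_def
    proof (rule cube_curve_code)
      fix i
      have "- L < x $ i" "x $ i < L"
        using that[rule_format, of i] by (auto simp: abs_less_iff)
      then show "0 \<le> (\<chi> i. (x $ i + L) / (2 * L)) $ i" "(\<chi> i. (x $ i + L) / (2 * L)) $ i < 1"
        using L(1) by (auto simp: field_simps)
    qed
    then show ?thesis
      unfolding \<phi>_def vec_eq_iff using L(1) by simp
  qed
  \<comment> \<open>\<open>tight\<close> uses intervals open on the left, and \<open>s\<close> may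
    take the value 0; hence a left end below 0.\<close>
  have s_bounds: "- 1 < s x \<and> s x \<le> 1" for x
    using cube_code_bounds[of "\<chi> i. (x $ i + L) / (2 * L)"] unfolding s_def by linarith
  define \<mu>' where "\<mu>' n = distr (\<mu> n) borel s" for n
  have s_meas': "s \<in> borel_measurable (\<mu> n)" for n
    using s_meas by (simp cong: measurable_cong_sets add: sets)
  have rd: "real_distribution (\<mu>' n)" for n
    unfolding \<mu>'_def using prob s_meas' by (intro prob_space.real_distribution_distr)
  have "tight \<mu>'"
    unfolding tight_def
  proof (intro conjI allI impI)
    fix \<epsilon> :: real assume "0 < \<epsilon>"
    have "measure (\<mu>' n) {- 1<..1} = 1" for n
    proof -
      interpret prob_space "\<mu> n" by (rule prob)
      have "measure (\<mu>' n) {- 1<..1} = prob (s -` {- 1<..1} \<inter> space (\<mu> n))"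
        unfolding \<mu>'_def by (intro measure_distr s_meas') auto
      also have "s -` {- 1<..1} \<inter> space (\<mu> n) = space (\<mu> n)"
        using s_bounds by auto
      finally show ?thesis by (simp add: prob_space)
    qed
    then show "\<exists>a b. a < b \<and> (\<forall>n. 1 - \<epsilon> < measure (\<mu>' n) {a<..b})"
      using \<open>0 < \<epsilon>\<close> by (intro exI[of _ "-1"] exI[of _ 1]) auto
  qed (rule rd)
  from tight_imp_convergent_subsubsequence[OF this strict_mono_id]
  obtain r \<nu>' where r: "strict_mono (r :: nat \<Rightarrow> nat)" and \<nu>': "real_distribution \<nu>'"
    and conv: "weak_conv_m (\<lambda>n. \<mu>' (r n)) \<nu>'"
    by (auto simp: comp_def id_def)
  interpret \<nu>': real_distribution \<nu>' by (rule \<nu>')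
  have \<phi>_\<nu>': "\<phi> \<in> borel_measurable \<nu>'"
    using \<phi>_meas by simp
  show ?thesis
  proof (rule exI[of _ "distr \<nu>' borel \<phi>"], rule exI[of _ r], intro conjI allI impI)
    show "prob_space (distr \<nu>' borel \<phi>)"
      by (intro \<nu>'.prob_space_distr \<phi>_\<nu>')
    fix f :: "real ^ 'n \<Rightarrow> real" and B
    assume f: "continuous_on UNIV f" and B: "\<forall>x. \<bar>f x\<bar> \<le> B"
    have f_meas: "f \<in> borel_measurable borel"
      using f by (rule borel_measurable_continuous_onI)
    have "continuous_on UNIV (\<lambda>t. f (\<phi> t))"
      by (intro continuous_on_compose2[OF f \<phi>_cont]) auto
    then have "isCont (\<lambda>t. f (\<phi> t)) t" for t
      by (simp add: continuous_on_eq_continuous_at)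
    then have "(\<lambda>n. integral\<^sup>L (\<mu>' (r n)) (\<lambda>t. f (\<phi> t))) \<longlonglongrightarrow> integral\<^sup>L \<nu>' (\<lambda>t. f (\<phi> t))"
      using B by (intro weak_conv_imp_integral_bdd_continuous_conv[OF rd \<nu>' conv, of _ B]) auto
    moreover have "integral\<^sup>L (\<mu>' n) (\<lambda>t. f (\<phi> t)) = integral\<^sup>L (\<mu> n) f" for n
    proof -
      have "integral\<^sup>L (\<mu>' n) (\<lambda>t. f (\<phi> t)) = integral\<^sup>L (\<mu> n) (\<lambda>x. f (\<phi> (s x)))"
        unfolding \<mu>'_def by (intro integral_distr s_meas' measurable_compose[OF \<phi>_meas f_meas])
      also have "\<dots> = integral\<^sup>L (\<mu> n) f"
      proof (rule integral_cong_AE)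
        show "AE x in \<mu> n. f (\<phi> (s x)) = f x"
          using L(2)[of n] by eventually_elim (simp add: \<phi>s)
        show "f \<in> borel_measurable (\<mu> n)"
          using f_meas by (simp cong: measurable_cong_sets add: sets)
        show "(\<lambda>x. f (\<phi> (s x))) \<in> borel_measurable (\<mu> n)"
          by (intro measurable_compose[OF s_meas'] measurable_compose[OF \<phi>_meas f_meas])
      qed
      finally show ?thesis .
    qed
    moreover have "integral\<^sup>L \<nu>' (\<lambda>t. f (\<phi> t)) = integral\<^sup>L (distr \<nu>' borel \<phi>) f"
      by (intro integral_distr[symmetric] \<phi>_\<nu>' f_meas)
    ultimately show "(\<lambda>n. integral\<^sup>L (\<mu> (r n)) f) \<longlonglongrightarrow> integral\<^sup>L (distr \<nu>' borel \<phi>) f"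
      by simp
  qed (use r in auto)
qed

text \<open>A continuous function squeezed between the indicators of \<open>{..x}\<close> and of a
  slightly larger orthant gives inequalities between the limit law and \<open>K\<close> at
  neighbouring points. Right continuity of both closes the gap, so no discussion of boundary mass is
  needed.\<close>

lemma multi_df_limit:
  fixes \<mu> :: "nat \<Rightarrow> (real ^ 'n::finite) measure"
  assumes prob: "\<And>n. prob_space (\<mu> n)" and sets: "\<And>n. sets (\<mu> n) = sets borel"
    and L: "0 < L" "\<And>n. AE x in \<mu> n. \<forall>i. \<bar>x $ i\<bar> < L"
    and lim: "\<And>x. x0 \<le> x \<Longrightarrow> (\<lambda>n. measure (\<mu> n) {..x}) \<longlonglongrightarrow> K x"
    and K: "\<And>x. x0 \<le> x \<Longrightarrow> (\<lambda>k. K (\<chi> i. x $ i + 1 / Suc k)) \<longlonglongrightarrow> K x"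
  obtains W where "multi_df W" "\<And>x. x0 \<le> x \<Longrightarrow> W x = K x"
proof -
  obtain \<nu> and r :: "nat \<Rightarrow> nat" where \<nu>: "prob_space \<nu>" "sets \<nu> = sets borel" and r: "strict_mono r"
    and conv: "\<forall>(f :: real ^ 'n \<Rightarrow> real) B. continuous_on UNIV f \<longrightarrow> (\<forall>x. \<bar>f x\<bar> \<le> B) \<longrightarrow>
      (\<lambda>n. integral\<^sup>L (\<mu> (r n)) f) \<longlonglongrightarrow> integral\<^sup>L \<nu> f"
    using bounded_weak_limit[where \<mu> = \<mu>, OF prob sets L] by blast
  interpret \<nu>: prob_space \<nu> by fact
  have squeeze: "measure \<nu> {..x} \<le> K (\<chi> i. x $ i + 1 / Suc k) \<and>
      K x \<le> measure \<nu> {..\<chi> i. x $ i + 1 / Suc k}" if x: "x0 \<le> x" for x k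
  proof -
    define x' where "x' = (\<chi> i. x $ i + 1 / Suc k)"
    \<comment> \<open>Equal to 1 on \<open>{..x}\<close>, and 0 as soon as one coordinate exceeds
      that of \<open>x\<close> by \<open>1 / Suc k\<close>.\<close>
    define f where "f y = max 0 (1 - Suc k * (\<Sum>i\<in>UNIV. max 0 (y $ i - x $ i)))" for y
    have x': "x0 \<le> x'"
      unfolding x'_def using x by (auto simp: less_eq_vec_def intro: add_increasing2)
    have f_cont: "continuous_on UNIV f"
      unfolding f_def by (intro continuous_intros)
    have f_bounds: "0 \<le> f y" "f y \<le> 1" for y
      unfolding f_def by (auto intro!: mult_nonneg_nonneg sum_nonneg)
    have f_lower: "indicator {..x} y \<le> f y" for y
    proof (cases "y \<le> x")
      case True
      then have "(\<Sum>i\<in>UNIV. max 0 (y $ i - x $ i)) = 0"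
        by (intro sum.neutral) (auto simp: less_eq_vec_def)
      then show ?thesis
        unfolding f_def by (simp add: indicator_def)
    qed (use f_bounds in auto)
    have f_upper: "f y \<le> indicator {..x'} y" for y
    proof (cases "y \<le> x'")
      case False
      then obtain i where i: "x $ i + 1 / Suc k < y $ i"
        unfolding x'_def by (auto simp: less_eq_vec_def not_le)
      have "1 / Suc k \<le> max 0 (y $ i - x $ i)"
        using i by simp
      also have "\<dots> \<le> (\<Sum>i\<in>UNIV. max 0 (y $ i - x $ i))"
        by (intro member_le_sum) auto
      finally have "1 \<le> Suc k * (\<Sum>i\<in>UNIV. max 0 (y $ i - x $ i))"
        by (simp add: field_simps)
      then show ?thesis
        unfolding f_def by simp
    qed (use f_bounds in auto)
    have f_int: "measure M {..x} \<le> integral\<^sup>L M f" "integral\<^sup>L M f \<le> measure M {..x'}"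
      if M: "prob_space M" "sets M = sets borel" for M
    proof -
      interpret M: prob_space M by fact
      have [simp]: "space M = UNIV"
        using sets_eq_imp_space_eq[OF M(2)] by simp
      have f_integrable: "integrable M f"
        using f_bounds borel_measurable_continuous_onI[OF f_cont]
        by (intro M.integrable_const_bound[of _ 1]) (auto cong: measurable_cong_sets simp: M(2))
      have ind: "integrable M (indicator {..z} :: _ \<Rightarrow> real)" for z
        by (intro integrable_real_indicator) (auto simp: M(2) M.emeasure_eq_measure)
      have "integral\<^sup>L M (indicator {..x} :: _ \<Rightarrow> real) \<le> integral\<^sup>L M f"
        by (intro integral_mono f_integrable ind f_lower)
      then show "measure M {..x} \<le> integral\<^sup>L M f"
        by simp
      have "integral\<^sup>L M f \<le> integral\<^sup>L M (indicator {..x'} :: _ \<Rightarrow> real)"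
        by (intro integral_mono f_integrable ind f_upper)
      then show "integral\<^sup>L M f \<le> measure M {..x'}"
        by simp
    qed
    have f_lim: "(\<lambda>n. integral\<^sup>L (\<mu> (r n)) f) \<longlonglongrightarrow> integral\<^sup>L \<nu> f"
      using f_bounds by (intro conv[rule_format, OF f_cont, of 1]) simp
    have sub: "(\<lambda>n. measure (\<mu> (r n)) {..z}) \<longlonglongrightarrow> K z" if "x0 \<le> z" for z
      using LIMSEQ_subseq_LIMSEQ[OF lim[OF that] r] by (simp add: comp_def)
    have "integral\<^sup>L \<nu> f \<le> K x'"
      using f_int(2)[OF prob sets] by (intro LIMSEQ_le[OF f_lim sub[OF x']]) auto
    moreover have "K x \<le> integral\<^sup>L \<nu> f"
      using f_int(1)[OF prob sets] by (intro LIMSEQ_le[OF sub[OF x] f_lim]) auto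
    ultimately show ?thesis
      using f_int[OF \<nu>] unfolding x'_def by linarith
  qed
  show thesis
  proof (rule that[of "\<lambda>x. measure \<nu> {..x}"])
    show "multi_df (\<lambda>x. measure \<nu> {..x})"
      unfolding multi_df_def using \<nu> by blast
    fix x assume x: "x0 \<le> x"
    have "(\<lambda>k. measure \<nu> {..\<chi> i. x $ i + 1 / Suc k}) \<longlonglongrightarrow> measure \<nu> (\<Inter>k. {..\<chi> i. x $ i + 1 / Suc k})"
    proof (rule \<nu>.finite_Lim_measure_decseq)
      show "range (\<lambda>k. {..\<chi> i. x $ i + 1 / Suc k}) \<subseteq> sets \<nu>"
        by (intro image_subsetI) (simp add: \<nu>(2) sets_atMost_vec)
      show "decseq (\<lambda>k. {..\<chi> i. x $ i + 1 / Suc k})"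
      proof (intro decseq_SucI subsetI)
        fix k y assume y: "y \<in> {..\<chi> i. x $ i + 1 / Suc (Suc k)}"
        have "1 / real (Suc (Suc k)) \<le> 1 / real (Suc k)"
          by (intro divide_left_mono) auto
        with y show "y \<in> {..\<chi> i. x $ i + 1 / Suc k}"
          unfolding atMost_iff less_eq_vec_def vec_lambda_beta by (meson add_left_mono order_trans)
      qed
    qed
    also have "(\<Inter>k. {..\<chi> i. x $ i + 1 / Suc k}) = {..x}"
    proof (intro equalityI subsetI)
      fix y assume y: "y \<in> (\<Inter>k. {..\<chi> i. x $ i + 1 / Suc k})"
      have "y $ i \<le> x $ i" for i
      proof (rule LIMSEQ_le_const)
        show "(\<lambda>k. x $ i + 1 / Suc k) \<longlonglongrightarrow> x $ i"
          using tendsto_add[OF tendsto_const LIMSEQ_inverse_real_of_nat, of "x $ i"]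
          by (simp add: inverse_eq_divide)
        show "\<exists>N. \<forall>n\<ge>N. y $ i \<le> x $ i + 1 / Suc n"
          using y by (intro exI[of _ 0]) (simp add: less_eq_vec_def)
      qed
      then show "y \<in> {..x}"
        by (simp add: less_eq_vec_def)
    next
      fix y assume "y \<in> {..x}"
      then have "y $ i \<le> x $ i + 1 / Suc k" for i k
        using add_increasing2[of "1 / real (Suc k)" "y $ i" "x $ i"] by (simp add: less_eq_vec_def)
      then show "y \<in> (\<Inter>k. {..\<chi> i. x $ i + 1 / Suc k})"
        by (simp add: less_eq_vec_def)
    qed
    finally have "K x \<le> measure \<nu> {..x}"
      using squeeze[OF x] by (intro LIMSEQ_le_const) auto
    moreover have "measure \<nu> {..x} \<le> K x"
      using squeeze[OF x] by (intro LIMSEQ_le_const[OF K[OF x]]) auto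
    ultimately show "measure \<nu> {..x} = K x"
      by simp
  qed
qed

section \<open>Margins of extreme value distributions\<close>

text \<open>\<open>margin\<close> is a limit along equal coordinates, but an affine map
  \<open>c * x + d\<close> moves them at different speeds. The union bound shows that the speeds do
  not matter.\<close>

lemma multi_df_tendsto_margin:
  fixes F :: "real ^ 'n::finite \<Rightarrow> real"
  assumes "multi_df F"
    and t: "\<And>s. x s $ i = t" and inf: "\<And>j. j \<noteq> i \<Longrightarrow> filterlim (\<lambda>s. x s $ j) at_top A"
  shows "((\<lambda>s. F (x s)) \<longlongrightarrow> margin F i t) A"
proof (rule tendsto_sandwich)
  show "\<forall>\<^sub>F s in A. margin F i t - (\<Sum>j\<in>UNIV - {i}. 1 - margin F j (x s $ j)) \<le> F (x s)"
    using margin_minus_multi_df[OF assms(1), of i "x s" for s]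
    by (intro always_eventually allI) (simp add: t algebra_simps)
  show "\<forall>\<^sub>F s in A. F (x s) \<le> margin F i t"
    using multi_df_le_margin[OF assms(1), of "x s" i for s] by (simp add: t)
  have "((\<lambda>s. margin F i t - (\<Sum>j\<in>UNIV - {i}. 1 - margin F j (x s $ j)))
      \<longlongrightarrow> margin F i t - (\<Sum>j\<in>UNIV - {i}. 1 - 1)) A"
    by (intro tendsto_intros filterlim_compose[OF univ_df_at_top[OF univ_df_margin[OF assms(1)]] inf]) auto
  then show "((\<lambda>s. margin F i t - (\<Sum>j\<in>UNIV - {i}. 1 - margin F j (x s $ j))) \<longlongrightarrow> margin F i t) A"
    by simp
qed auto

lemma filterlim_affine_at_top:
  fixes c d :: real
  assumes "0 < c"
  shows "filterlim (\<lambda>s. c * s + d) at_top at_top"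
proof -
  have "filterlim (\<lambda>s. d + c * s) at_top at_top"
    using assms
    by (intro filterlim_tendsto_add_at_top[OF tendsto_const] filterlim_tendsto_pos_mult_at_top[OF tendsto_const])
      (auto intro: filterlim_ident)
  then show ?thesis by (simp add: add.commute)
qed

lemma evd_stable:
  fixes G :: "real ^ 'n::finite \<Rightarrow> real"
  assumes "evd G" "1 \<le> n"
  obtains c d where "\<And>i. 0 < c $ i" "\<And>x. G (c * x + d) ^ n = G x"
    "\<And>i t. margin G i (c $ i * t + d $ i) ^ n = margin G i t"
proof -
  have df: "multi_df G"
    using assms unfolding evd_def by auto
  obtain c d where c: "\<And>i. 0 < c $ i" and eq: "\<And>x. G (c * x + d) ^ n = G x"
    using assms unfolding evd_def by blast
  have "margin G i (c $ i * t + d $ i) ^ n = margin G i t" for i t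
  proof -
    let ?x = "\<lambda>s. \<chi> j. if j = i then t else s"
    have "((\<lambda>s. G (c * ?x s + d)) \<longlongrightarrow> margin G i (c $ i * t + d $ i)) at_top"
      by (intro multi_df_tendsto_margin df) (auto intro!: filterlim_affine_at_top c)
    then have "((\<lambda>s. G (c * ?x s + d) ^ n) \<longlongrightarrow> margin G i (c $ i * t + d $ i) ^ n) at_top"
      by (rule tendsto_power)
    then have "((\<lambda>s. G (?x s)) \<longlongrightarrow> margin G i (c $ i * t + d $ i) ^ n) at_top"
      unfolding eq .
    from tendsto_unique[OF _ this tendsto_margin'[OF df]] show ?thesis
      by simp
  qed
  with c eq that show thesis by blast
qed

lemma univ_evd_margin:
  fixes G :: "real ^ 'n::finite \<Rightarrow> real"
  assumes "evd G"
  shows "univ_evd (margin G i)"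
  unfolding univ_evd_def
proof (intro conjI allI impI)
  show "univ_df (margin G i)" "nondegenerate (margin G i)"
    using assms univ_df_margin unfolding evd_def by auto
  fix n :: nat assume "1 \<le> n"
  from evd_stable[OF assms this] show "\<exists>c>0. \<exists>d. \<forall>x. margin G i (c * x + d) ^ n = margin G i x"
    by metis
qed

lemma right_continuous_mono_univ_df:
  assumes "univ_df g"
  shows "right_continuous_mono g 0 1"
  using univ_df_right_cont[OF assms] univ_df_at_bot[OF assms] univ_df_at_top[OF assms]
    univ_df_mono[OF assms]
  by unfold_locales (auto intro: monoI)

text \<open>A distribution function with values 0 and 1 only jumps once, at its quantile of level
  1/2, and right continuity puts it in the form that \<open>nondegenerate\<close> excludes.\<close>

lemma univ_evd_proper_value:
  assumes "univ_evd g"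
  obtains x where "0 < g x" "g x < 1"
proof -
  have df: "univ_df g" and nd: "nondegenerate g"
    using assms unfolding univ_evd_def by auto
  have "\<exists>x. 0 < g x \<and> g x < 1"
  proof (rule ccontr)
    assume "\<not> ?thesis"
    then have g01: "g x = 0 \<or> g x = 1" for x
      using univ_df_nonneg[OF df, of x] univ_df_le_1[OF df, of x] by (metis order_le_less)
    interpret right_continuous_mono g 0 1
      by (rule right_continuous_mono_univ_df[OF df])
    have "1 / 2 \<le> g x \<longleftrightarrow> I (1 / 2) \<le> x" for x
      by (rule pseudoinverse) auto
    then have "g x = (if I (1 / 2) \<le> x then 1 else 0)" for x
      using g01[of x] by (smt (verit) field_sum_of_halves)
    with nd show False
      unfolding nondegenerate_def by blast
  qed
  with that show thesis by blast
qed

text \<open>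
  Max-stability makes the range of \<open>- ln g\<close> invariant under multiplication by positive rationals.
\<close>

lemma univ_evd_dense_range:
  assumes g: "univ_evd g" and "0 \<le> p" "p < q" "q \<le> 1"
  obtains x where "p < g x" "g x < q"
proof -
  have stable: "\<exists>c>0. \<exists>d. \<forall>x. g (c * x + d) ^ n = g x" if "1 \<le> n" for n
    using g that unfolding univ_evd_def by blast
  obtain x0 where x0: "0 < g x0" "g x0 < 1"
    using univ_evd_proper_value[OF g] .
  define l where "l = - ln (g x0)"
  \<comment> \<open>By convention \<open>ln 0 = 0\<close>, so the level 0 is replaced by a positive
    one below \<open>q\<close>.\<close>
  define p' where "p' = (if p = 0 then q / 2 else p)"
  have p': "0 < p'" "p \<le> p'" "p' < q"
    unfolding p'_def using assms by auto
  have l: "0 < l"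
    unfolding l_def using x0 by simp
  have "- ln q / l < - ln p' / l"
    using p' l by (simp add: divide_strict_right_mono)
  then obtain r where r: "r \<in> \<rat>" "- ln q / l < r" "r < - ln p' / l"
    using Rats_dense_in_real by blast
  have "0 \<le> - ln q / l"
    using l assms p' by (simp add: divide_nonpos_pos)
  then have "0 < r"
    using r by linarith
  obtain a' b' :: int where ab': "b' > 0" "r = real_of_int a' / real_of_int b'"
    using r(1) by (rule Rats_cases')
  then have "a' > 0"
    using \<open>0 < r\<close> by (simp add: zero_less_divide_iff)
  define a b where "a = nat a'" and "b = nat b'"
  have ab: "0 < b" "0 < a" "r = real a / real b"
    unfolding a_def b_def using ab' \<open>a' > 0\<close> by auto
  \<comment> \<open>The value \<open>g x0\<close> is raised to the power \<open>a / b\<close>: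
    stability for \<open>b\<close> supplies a point where \<open>g\<close> is the
    \<open>b\<close>-th root, and solving the affine map of stability for \<open>a\<close> yields
    \<open>y\<close>, where \<open>g\<close> is the \<open>a\<close>-th power of that root.\<close>
  obtain c d where c: "g (c * x0 + d) ^ b = g x0"
    using stable[of b] ab by auto
  obtain c' d' where c': "0 < c'" "\<And>x. g (c' * x + d') ^ a = g x"
    using stable[of a] ab by auto
  define y where "y = (c * x0 + d - d') / c'"
  have y: "g y = g (c * x0 + d) ^ a"
    using c'(1) c'(2)[of y] unfolding y_def by simp
  have pos: "0 < g (c * x0 + d)"
  proof (rule ccontr)
    assume "\<not> 0 < g (c * x0 + d)"
    then have "g (c * x0 + d) = 0"
      using g univ_df_nonneg[of g "c * x0 + d"] unfolding univ_evd_def by linarith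
    then show False
      using c x0(1) ab(1) by (simp add: zero_power)
  qed
  have "b * ln (g (c * x0 + d)) = ln (g (c * x0 + d) ^ b)"
    using pos by (simp add: ln_realpow)
  then have "b * ln (g (c * x0 + d)) = - l"
    unfolding c l_def by simp
  then have ln: "ln (g (c * x0 + d)) = - l / b"
    using ab(1) by (simp add: field_simps)
  have gy: "0 < g y"
    unfolding y using pos by simp
  have "ln (g y) = a * ln (g (c * x0 + d))"
    unfolding y using pos by (simp add: ln_realpow)
  also have "\<dots> = - (r * l)"
    unfolding ln ab(3) by simp
  finally have "ln (g y) = - (r * l)" .
  moreover have "- ln q < r * l"
    by (rule pos_divide_less_eq[OF l, THEN iffD1, OF r(2)])
  moreover have "r * l < - ln p'"
    by (rule pos_less_divide_eq[OF l, THEN iffD1, OF r(3)])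
  ultimately have "ln p' < ln (g y)" "ln (g y) < ln q"
    by linarith+
  then have "p' < g y" "g y < q"
    using gy p' by (simp_all add: ln_less_cancel_iff)
  with p'(2) show thesis
    by (intro that[of y]) linarith+
qed

text \<open>The limits in \<open>n\<close> and in \<open>s\<close> have to be interchanged. For
  fixed \<open>s\<close> the \<open>n\<close>-th powers of the margin and of \<open>F\<close> differ
  by at most \<open>m * (n * (1 - F))\<close> with \<open>F\<close> taken on the rescaled diagonal.
  This tends to \<open>- m * ln (G (\<chi> j. s))\<close>, which is small for large
  \<open>s\<close>; hence \<open>s\<close> is fixed before \<open>n\<close>.\<close>

lemma domain_of_attraction_margin:
  fixes F G :: "real ^ 'n::finite \<Rightarrow> real"
  assumes F: "multi_df F" and G: "multi_df G" and a: "\<And>n i. 0 < a n $ i"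
    and lim: "\<And>x. (\<lambda>n. F (a n * x + b n) ^ n) \<longlonglongrightarrow> G x"
  shows "(\<lambda>n. margin F i (a n $ i * t + b n $ i) ^ n) \<longlonglongrightarrow> margin G i t"
proof (rule tendstoI)
  fix e :: real assume e: "0 < e"
  define m where "m = real CARD('n)"
  let ?x = "\<lambda>s. (\<chi> j. if j = i then t else s) :: real ^ 'n"
  have diag: "((\<lambda>s. G (\<chi> j. s)) \<longlongrightarrow> 1) at_top"
    by (rule multi_df_diagonal_at_top[OF G])
  have "((\<lambda>s. m * - ln (G (\<chi> j. s))) \<longlongrightarrow> m * - ln 1) at_top"
    by (intro tendsto_intros diag) simp
  then have "\<forall>\<^sub>F s in at_top. m * - ln (G (\<chi> j. s)) < e / 4"
    using e by (intro order_tendstoD(2)) auto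
  moreover have "\<forall>\<^sub>F s in at_top. 0 < G (\<chi> j. s)"
    by (intro order_tendstoD(1)[OF diag]) simp
  moreover have "\<forall>\<^sub>F s in at_top. dist (G (?x s)) (margin G i t) < e / 4"
    using e by (intro tendstoD[OF tendsto_margin'[OF G]]) simp
  ultimately have "\<forall>\<^sub>F s in at_top. m * - ln (G (\<chi> j. s)) < e / 4 \<and> 0 < G (\<chi> j. s)
      \<and> dist (G (?x s)) (margin G i t) < e / 4"
    by eventually_elim auto
  then obtain s where s: "m * - ln (G (\<chi> j. s)) < e / 4" "0 < G (\<chi> j. s)"
    "dist (G (?x s)) (margin G i t) < e / 4"
    using eventually_happens'[OF trivial_limit_at_top_linorder] by blast
  have "(\<lambda>n. n * (1 - F (a n * (\<chi> j. s) + b n))) \<longlonglongrightarrow> - ln (G (\<chi> j. s))"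
    using multi_df_nonneg[OF F] multi_df_le_1[OF F] by (intro tendsto_exp_power lim s) auto
  then have "(\<lambda>n. m * (n * (1 - F (a n * (\<chi> j. s) + b n)))) \<longlonglongrightarrow> m * - ln (G (\<chi> j. s))"
    by (intro tendsto_intros)
  then have "\<forall>\<^sub>F n in sequentially. m * (n * (1 - F (a n * (\<chi> j. s) + b n))) < e / 4"
    using s(1) by (rule order_tendstoD(2))
  moreover have "\<forall>\<^sub>F n in sequentially. dist (F (a n * ?x s + b n) ^ n) (G (?x s)) < e / 4"
    using e by (intro tendstoD[OF lim]) simp
  ultimately show "\<forall>\<^sub>F n in sequentially.
      dist (margin F i (a n $ i * t + b n $ i) ^ n) (margin G i t) < e"
  proof eventually_elim
    case (elim n)
    let ?Fi = "margin F i (a n $ i * t + b n $ i)" and ?F = "F (a n * ?x s + b n)"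
    note mdf = univ_df_margin[OF F]
    have le: "?F \<le> ?Fi"
      using multi_df_le_margin[OF F, of "a n * ?x s + b n" i] by simp
    have "?Fi - ?F \<le> (\<Sum>j\<in>UNIV - {i}. 1 - margin F j ((a n * ?x s + b n) $ j))"
      using margin_minus_multi_df[OF F, of i "a n * ?x s + b n"] by simp
    also have "\<dots> = (\<Sum>j\<in>UNIV - {i}. 1 - margin F j ((a n * (\<chi> j. s) + b n) $ j))"
      by (intro sum.cong) auto
    also have "\<dots> \<le> (\<Sum>j\<in>UNIV - {i}. 1 - F (a n * (\<chi> j. s) + b n))"
      by (intro sum_mono diff_left_mono multi_df_le_margin F)
    also have "\<dots> \<le> (\<Sum>j\<in>(UNIV :: 'n set). 1 - F (a n * (\<chi> j. s) + b n))"
      by (intro sum_mono2) (auto simp: multi_df_le_1[OF F])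
    also have "\<dots> = m * (1 - F (a n * (\<chi> j. s) + b n))"
      by (simp add: m_def)
    finally have "real n * \<bar>?Fi - ?F\<bar> \<le> n * (m * (1 - F (a n * (\<chi> j. s) + b n)))"
      using le by (intro mult_left_mono) auto
    then have "n * \<bar>?Fi - ?F\<bar> < e / 4"
      using elim(1) unfolding mult.left_commute[of "real n" m] by linarith
    moreover have "\<bar>?Fi ^ n - ?F ^ n\<bar> \<le> n * \<bar>?Fi - ?F\<bar>"
      by (intro abs_power_diff_le univ_df_nonneg[OF mdf] univ_df_le_1[OF mdf]
          multi_df_nonneg[OF F] multi_df_le_1[OF F])
    ultimately show ?case
      using elim(2) s(3) e unfolding dist_real_def by linarith
  qed
qed

section \<open>Copulas\<close>

lemma copula_margin:
  fixes C :: "real ^ 'n::finite \<Rightarrow> real"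
  assumes "copula C"
  shows "margin C i t = max 0 (min 1 t)"
proof -
  have df: "univ_df (margin C i)"
    using assms univ_df_margin unfolding copula_def by auto
  have unif: "margin C i t = t" if "0 \<le> t" "t \<le> 1" for t
    using assms that unfolding copula_def by auto
  consider "t < 0" | "0 \<le> t" "t \<le> 1" | "1 < t" by linarith
  then show ?thesis
  proof cases
    case 1
    then show ?thesis
      using univ_df_mono[OF df, of t 0] univ_df_nonneg[OF df, of t] unif[of 0] by simp
  next
    case 3
    then show ?thesis
      using univ_df_mono[OF df, of 1 t] univ_df_le_1[OF df, of t] unif[of 1] by simp
  qed (simp add: unif)
qed

lemma copula_Lipschitz:
  fixes C :: "real ^ 'n::finite \<Rightarrow> real"
  assumes "copula C"
  shows "\<bar>C x - C y\<bar> \<le> (\<Sum>i\<in>UNIV. \<bar>x $ i - y $ i\<bar>)"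
proof -
  have "\<bar>C x - C y\<bar> \<le> (\<Sum>i\<in>UNIV. \<bar>margin C i (x $ i) - margin C i (y $ i)\<bar>)"
    using assms by (intro multi_df_Lipschitz) (simp add: copula_def)
  also have "\<dots> \<le> (\<Sum>i\<in>UNIV. \<bar>x $ i - y $ i\<bar>)"
    unfolding copula_margin[OF assms] by (intro sum_mono) (auto simp: max_def min_def)
  finally show ?thesis .
qed

text \<open>The estimate that separates dependence from margins: of the sequence \<open>u n\<close>
  only the rates \<open>n * (1 - u n $ i)\<close> survive in the limit, because \<open>n\<close>
  times the Lipschitz bound is the sum of their deviations from \<open>v\<close>.\<close>

lemma copula_power_diff_tendsto:
  fixes C :: "real ^ 'n::finite \<Rightarrow> real"
  assumes C: "copula C" and u: "\<And>i. (\<lambda>n. n * (1 - u n $ i)) \<longlonglongrightarrow> v $ i"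
  shows "(\<lambda>n. C (u n) ^ n - C (1 - v /\<^sub>R n) ^ n) \<longlonglongrightarrow> 0"
proof (rule Lim_null_comparison)
  have df: "multi_df C"
    using C by (simp add: copula_def)
  show "\<forall>\<^sub>F n in sequentially. norm (C (u n) ^ n - C (1 - v /\<^sub>R n) ^ n)
      \<le> (\<Sum>i\<in>UNIV. \<bar>n * (1 - u n $ i) - v $ i\<bar>)"
    using eventually_gt_at_top[of 0]
  proof eventually_elim
    case (elim n)
    have "norm (C (u n) ^ n - C (1 - v /\<^sub>R n) ^ n) \<le> n * \<bar>C (u n) - C (1 - v /\<^sub>R n)\<bar>"
      unfolding real_norm_def
      by (intro abs_power_diff_le multi_df_nonneg[OF df] multi_df_le_1[OF df])
    also have "\<dots> \<le> n * (\<Sum>i\<in>UNIV. \<bar>u n $ i - (1 - v /\<^sub>R n) $ i\<bar>)"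
      by (intro mult_left_mono copula_Lipschitz C) simp
    also have "\<dots> = (\<Sum>i\<in>UNIV. \<bar>n * (u n $ i - (1 - v /\<^sub>R n) $ i)\<bar>)"
      by (simp add: sum_distrib_left abs_mult)
    also have "\<dots> = (\<Sum>i\<in>UNIV. \<bar>n * (1 - u n $ i) - v $ i\<bar>)"
    proof (intro sum.cong refl)
      fix i
      have "n * (u n $ i - (1 - v /\<^sub>R n) $ i) = - (n * (1 - u n $ i) - v $ i)"
        using elim by (simp add: field_simps)
      then show "\<bar>n * (u n $ i - (1 - v /\<^sub>R n) $ i)\<bar> = \<bar>n * (1 - u n $ i) - v $ i\<bar>"
        by simp
    qed
    finally show ?case .
  qed
  have "(\<lambda>n. \<Sum>i\<in>UNIV. \<bar>n * (1 - u n $ i) - v $ i\<bar>) \<longlonglongrightarrow> (\<Sum>i\<in>(UNIV :: 'n set). \<bar>v $ i - v $ i\<bar>)"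
    by (intro tendsto_intros u)
  then show "(\<lambda>n. \<Sum>i\<in>UNIV. \<bar>n * (1 - u n $ i) - v $ i\<bar>) \<longlonglongrightarrow> 0"
    by simp
qed

section \<open>Extreme value distributions with negative exponential margins\<close>

lemma exp_margins:
  fixes G :: "real ^ 'n::finite \<Rightarrow> real"
  assumes "multi_df G" "\<And>i t. t \<le> 0 \<Longrightarrow> margin G i t = exp t"
  shows "margin G i t = exp (min t 0)"
proof (cases "t \<le> 0")
  case False
  have df: "univ_df (margin G i)"
    by (rule univ_df_margin[OF assms(1)])
  have "margin G i 0 = 1"
    using assms(2) by simp
  then show ?thesis
    using False univ_df_mono[OF df, of 0 t] univ_df_le_1[OF df, of t] by simp
qed (use assms in auto)

text \<open>The slope of \<open>exp\<close> is at most 1 on the negative half-line, and above 0 the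
  margins are constant.\<close>

lemma exp_margins_Lipschitz:
  fixes G :: "real ^ 'n::finite \<Rightarrow> real"
  assumes "multi_df G" "\<And>i t. t \<le> 0 \<Longrightarrow> margin G i t = exp t"
  shows "\<bar>G x - G y\<bar> \<le> (\<Sum>i\<in>UNIV. \<bar>x $ i - y $ i\<bar>)"
proof -
  have margin: "margin G i t = exp (min t 0)" for i t
    using assms by (rule exp_margins)
  have *: "exp s - exp t \<le> s - t" if "t \<le> s" "s \<le> 0" for s t :: real
  proof -
    have "exp s - exp t = exp s * (1 - exp (t - s))"
      by (simp add: algebra_simps flip: exp_add)
    also have "\<dots> \<le> 1 * (1 - exp (t - s))"
      using that by (intro mult_right_mono) auto
    also have "\<dots> \<le> s - t"
      using exp_ge_add_one_self[of "t - s"] by (simp only: mult_1 algebra_simps)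
    finally show ?thesis .
  qed
  have "\<bar>exp (min s 0) - exp (min t 0)\<bar> \<le> \<bar>s - t\<bar>" for s t :: real
  proof (cases "t \<le> s")
    case True
    then have "exp (min s 0) - exp (min t 0) \<le> min s 0 - min t 0" "exp (min t 0) \<le> exp (min s 0)"
      by (auto intro!: *)
    moreover have "min s 0 - min t 0 \<le> s - t"
      using True by linarith
    ultimately show ?thesis by linarith
  next
    case False
    then have "exp (min t 0) - exp (min s 0) \<le> min t 0 - min s 0" "exp (min s 0) \<le> exp (min t 0)"
      by (auto intro!: *)
    moreover have "min t 0 - min s 0 \<le> t - s"
      using False by linarith
    ultimately show ?thesis by linarith
  qed
  then have "(\<Sum>i\<in>UNIV. \<bar>margin G i (x $ i) - margin G i (y $ i)\<bar>) \<le> (\<Sum>i\<in>UNIV. \<bar>x $ i - y $ i\<bar>)"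
    unfolding margin by (intro sum_mono)
  moreover have "\<bar>G x - G y\<bar> \<le> (\<Sum>i\<in>UNIV. \<bar>margin G i (x $ i) - margin G i (y $ i)\<bar>)"
    by (rule multi_df_Lipschitz[OF assms(1)])
  ultimately show ?thesis by linarith
qed

definition neg_exp_evd :: "(real ^ 'n::finite \<Rightarrow> real) \<Rightarrow> bool" where
  "neg_exp_evd G \<longleftrightarrow> evd G \<and> (\<forall>i. \<forall>t\<le>0. margin G i t = exp t)"

lemma
  fixes G :: "real ^ 'n::finite \<Rightarrow> real"
  assumes "neg_exp_evd G"
  shows neg_exp_evd_margin: "margin G i t = exp (min t 0)"
    and neg_exp_evd_Lipschitz: "\<bar>G x - G y\<bar> \<le> (\<Sum>i\<in>UNIV. \<bar>x $ i - y $ i\<bar>)"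
  using assms exp_margins[of G] exp_margins_Lipschitz[of G] unfolding neg_exp_evd_def evd_def by auto

text \<open>Max-stability leaves the constants open. The margins fix them:
  \<open>n * min (c $ i * t + d $ i) 0 = t\<close> for negative \<open>t\<close> forces
  \<open>c $ i = 1 / n\<close> and \<open>d $ i = 0\<close>.\<close>

lemma neg_exp_evd_scale:
  fixes G :: "real ^ 'n::finite \<Rightarrow> real"
  assumes G: "neg_exp_evd G" and n: "1 \<le> n"
  shows "G (x /\<^sub>R n) ^ n = G x"
proof -
  obtain c d where c: "\<And>i. 0 < c $ i" and eq: "\<And>x. G (c * x + d) ^ n = G x"
    and margins: "\<And>i t. margin G i (c $ i * t + d $ i) ^ n = margin G i t"
    using evd_stable[of G n] assms unfolding neg_exp_evd_def by metis
  define k where "k = 1 / real n"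
  have t: "c $ i * t + d $ i = t * k" if "t < 0" for i t
  proof -
    have "exp (n * min (c $ i * t + d $ i) 0) = exp t"
      using margins[of i t] that unfolding neg_exp_evd_margin[OF G] exp_of_nat_mult by simp
    then have *: "n * min (c $ i * t + d $ i) 0 = t"
      by simp
    then have "min (c $ i * t + d $ i) 0 = t * k"
      unfolding k_def using n by (metis nonzero_mult_div_cancel_left not_one_le_zero of_nat_eq_0_iff
          times_divide_eq_right mult.right_neutral)
    moreover have "t * k < 0"
      unfolding k_def using n that by (simp add: divide_neg_pos)
    ultimately show ?thesis
      by linarith
  qed
  have cd: "c $ i * y + d $ i = y * k" for i y
  proof -
    \<comment> \<open>Two negative arguments determine the affine map.\<close>
    have "c $ i * - 1 + d $ i = - 1 * k" "c $ i * - 2 + d $ i = - 2 * k"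
      by (rule t; simp)+
    then have "c $ i = k" "d $ i = 0"
      by linarith+
    then show ?thesis by simp
  qed
  have "(c * x + d) $ i = (x /\<^sub>R n) $ i" for i
    using cd[of i "x $ i"] by (simp add: k_def divide_inverse)
  then have "c * x + d = x /\<^sub>R n"
    by (simp add: vec_eq_iff)
  then show ?thesis
    using eq[of x] by simp
qed

text \<open>By the union bound \<open>G\<close> is positive close to the origin, and
  \<open>G x\<close> is a power of its value at a point \<open>x / n\<close> that close.\<close>

lemma neg_exp_evd_pos:
  fixes G :: "real ^ 'n::finite \<Rightarrow> real"
  assumes G: "neg_exp_evd G"
  shows "0 < G x"
proof -
  have df: "multi_df G"
    using G unfolding neg_exp_evd_def evd_def by auto
  have "(\<lambda>n. \<Sum>i\<in>UNIV. 1 - exp (min (x $ i * inverse (real (Suc n))) 0))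
      \<longlonglongrightarrow> (\<Sum>i\<in>(UNIV::'n set). 1 - exp (min (x $ i * 0) 0))"
    by (intro tendsto_intros LIMSEQ_inverse_real_of_nat)
  then have "\<forall>\<^sub>F n in sequentially. (\<Sum>i\<in>UNIV. 1 - exp (min (x $ i * inverse (real (Suc n))) 0)) < 1"
    by (intro order_tendstoD(2)) auto
  then obtain n where n: "(\<Sum>i\<in>UNIV. 1 - exp (min (x $ i * inverse (real (Suc n))) 0)) < 1"
    by (auto dest: eventually_happens)
  have "1 - G (x /\<^sub>R Suc n) \<le> (\<Sum>i\<in>UNIV. 1 - exp (min (x $ i * inverse (real (Suc n))) 0))"
    using one_minus_multi_df_le[OF df, of "x /\<^sub>R Suc n"]
    unfolding neg_exp_evd_margin[OF G] by (simp add: mult.commute)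
  then have "0 < G (x /\<^sub>R Suc n)"
    using n by linarith
  then have "0 < G (x /\<^sub>R Suc n) ^ Suc n"
    by (rule zero_less_power)
  then show ?thesis
    using neg_exp_evd_scale[OF G, of "Suc n" x] by simp
qed

lemma neg_exp_evd_ln_scale:
  fixes G :: "real ^ 'n::finite \<Rightarrow> real" and n :: nat
  assumes G: "neg_exp_evd G" and n: "1 \<le> n"
  shows "ln (G (x /\<^sub>R n)) = ln (G x) / n"
proof -
  have "ln (G x) = ln (G (x /\<^sub>R n) ^ n)"
    by (simp only: neg_exp_evd_scale[OF assms])
  also have "\<dots> = n * ln (G (x /\<^sub>R n))"
    by (rule ln_realpow)
  finally show ?thesis
    using n by simp
qed

section \<open>Existence of generalized Pareto distributions\<close>

lemma neg_exp_evd_tendsto: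
  fixes G :: "real ^ 'n::finite \<Rightarrow> real"
  assumes G: "neg_exp_evd G"
  shows "(\<lambda>n. n * (1 - G (x /\<^sub>R n))) \<longlonglongrightarrow> - ln (G x)"
proof (rule tendsto_exp_power)
  have df: "multi_df G"
    using G unfolding neg_exp_evd_def evd_def by auto
  show "0 \<le> G (x /\<^sub>R n)" "G (x /\<^sub>R n) \<le> 1" for n :: nat
    using multi_df_nonneg[OF df] multi_df_le_1[OF df] by auto
  have "\<forall>\<^sub>F n :: nat in sequentially. G (x /\<^sub>R n) ^ n = G x"
    using eventually_ge_at_top[of 1] by eventually_elim (rule neg_exp_evd_scale[OF G])
  then show "(\<lambda>n :: nat. G (x /\<^sub>R n) ^ n) \<longlonglongrightarrow> G x"
    by (rule tendsto_eventually)
qed (rule neg_exp_evd_pos[OF G])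

lemma continuous_neg_exp_evd:
  fixes G :: "real ^ 'n::finite \<Rightarrow> real"
  assumes G: "neg_exp_evd G" and X: "\<And>i. ((\<lambda>s. X s $ i) \<longlongrightarrow> x $ i) A"
  shows "((\<lambda>s. G (X s)) \<longlongrightarrow> G x) A"
proof -
  have "((\<lambda>s. G (X s) - G x) \<longlongrightarrow> 0) A"
  proof (rule Lim_null_comparison)
    show "\<forall>\<^sub>F s in A. norm (G (X s) - G x) \<le> (\<Sum>i\<in>UNIV. \<bar>X s $ i - x $ i\<bar>)"
      using neg_exp_evd_Lipschitz[OF G] by (intro always_eventually) auto
    have "((\<lambda>s. \<Sum>i\<in>UNIV. \<bar>X s $ i - x $ i\<bar>) \<longlongrightarrow> (\<Sum>i\<in>(UNIV :: 'n set). \<bar>x $ i - x $ i\<bar>)) A"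
      by (intro tendsto_intros X)
    then show "((\<lambda>s. \<Sum>i\<in>UNIV. \<bar>X s $ i - x $ i\<bar>) \<longlongrightarrow> 0) A"
      by simp
  qed
  then show ?thesis
    using Lim_null by blast
qed

text \<open>
  The distribution function \<open>1 + ln G\<close> near the origin is the limit of the conditional laws of
  \<open>n Y\<close>, given that \<open>n Y \<le> x0\<close> fails, where \<open>Y\<close> has distribution function \<open>G\<close>. Truncation from
  below at \<open>- 2\<close> makes these laws uniformly bounded, and \<open>ln (G x0) = - 1\<close> normalizes the limit.
\<close>

lemma multi_df_one_plus_ln:
  fixes G :: "real ^ 'n::finite \<Rightarrow> real"
  assumes G: "neg_exp_evd G"
  obtains W x0 where "multi_df W" "\<And>i. x0 $ i < 0" "G x0 < 1" "\<And>x. x0 \<le> x \<Longrightarrow> W x = 1 + ln (G x)"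
proof -
  have df: "multi_df G"
    using G unfolding neg_exp_evd_def evd_def by auto
  obtain M where M: "prob_space M" "sets M = sets borel"
    and GM: "\<And>x. G x = measure M {..x}" "\<And>i t. margin G i t = measure M {y. y $ i \<le> t}"
    using multi_dfE[OF df] by metis
  interpret prob_space M by fact
  note meas = measure_Collect_le_nth[OF M(2)]
  have margin_G: "margin G i t = exp (min t 0)" for i t
    by (rule neg_exp_evd_margin[OF G])
  have "1 \<le> G 0"
    using one_minus_multi_df_le[OF df, of 0] by (simp add: margin_G)
  moreover have "exp (- 1) < (1 :: real)"
    by simp
  ultimately have e: "exp (- 1) \<le> G 0" "G 0 \<noteq> exp (- 1)"
    by linarith+
  have G1: "G (\<chi> i. - 1) \<le> exp (- 1)"
    using multi_df_le_margin[OF df, of "\<chi> i. - 1" undefined] by (simp add: margin_G)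
  \<comment> \<open>Along the diagonal \<open>G\<close> falls from 1 at the origin to at most
    \<open>exp (- 1)\<close> at -1, so the intermediate value theorem finds the normalizing point
    \<open>x0\<close>, with coordinates between -1 and 0.\<close>
  have "continuous_on {0..1} (\<lambda>s. - G (\<chi> i. - s))"
    unfolding continuous_on_def
  proof (intro ballI tendsto_minus continuous_neg_exp_evd[OF G])
    fix t :: real and i :: 'n
    have "((\<lambda>s. - s) \<longlongrightarrow> - t) (at t within {0..1})"
      by (intro tendsto_intros)
    then show "((\<lambda>s. (\<chi> i. - s) $ i) \<longlongrightarrow> (\<chi> i. - t) $ i) (at t within {0..1})"
      by simp
  qed
  moreover have "(\<chi> i. - 0) = (0 :: real ^ 'n)"
    by (simp add: vec_eq_iff)
  ultimately have "\<exists>s\<ge>0. s \<le> 1 \<and> - G (\<chi> i. - s) = - exp (- 1)"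
    using e G1 by (intro IVT') auto
  then obtain s where s: "0 \<le> s" "s \<le> 1" "G (\<chi> i. - s) = exp (- 1)"
    by auto
  define x0 :: "real ^ 'n" where "x0 = (\<chi> i. - s)"
  have lnx0: "ln (G x0) = - 1"
    using s(3) unfolding x0_def by simp
  have "s \<noteq> 0"
  proof
    assume "s = 0"
    then have "(\<chi> i. - s) = (0 :: real ^ 'n)"
      by (simp add: vec_eq_iff)
    then show False
      using s(3) e by simp
  qed
  then have x0: "x0 $ i < 0" "- 1 \<le> x0 $ i" for i
    using s unfolding x0_def by auto
  define A where "A n = space M - {..x0 /\<^sub>R Suc n}" for n
  \<comment> \<open>\<open>Suc n\<close> avoids division by zero. The level -2 lies below every
    coordinate of \<open>x0\<close>, so truncation does not change the events \<open>{..x}\<close>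
    with \<open>x0 \<le> x\<close>.\<close>
  define X :: "nat \<Rightarrow> real ^ 'n \<Rightarrow> real ^ 'n" where "X n y = (\<chi> i. max (- 2) (Suc n * y $ i))" for n y
  define \<mu> where "\<mu> n = distr (uniform_measure M (A n)) borel (X n)" for n
  have A: "A n \<in> sets M" for n
    unfolding A_def by (intro sets.Diff sets.top meas)
  have prob_A: "prob (A n) = 1 - G (x0 /\<^sub>R Suc n)" for n
    unfolding A_def GM by (intro prob_compl meas)
  have "G (x0 /\<^sub>R Suc n) < 1" for n
  proof -
    have "G (x0 /\<^sub>R Suc n) \<le> exp (min ((x0 /\<^sub>R Suc n) $ undefined) 0)"
      using multi_df_le_margin[OF df, of "x0 /\<^sub>R Suc n" undefined] by (simp add: neg_exp_evd_margin[OF G])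
    also have "(x0 /\<^sub>R Suc n) $ undefined < 0"
      using x0(1)[of undefined] by (simp add: mult_pos_neg)
    then have "exp (min ((x0 /\<^sub>R Suc n) $ undefined) 0) < 1"
      by (subst exp_less_one_iff) linarith
    finally show ?thesis .
  qed
  then have pos: "0 < prob (A n)" for n
    unfolding prob_A by simp
  have em: "emeasure M (A n) \<noteq> 0" "emeasure M (A n) \<noteq> \<infinity>" for n
    using order_less_imp_not_eq2[OF pos[of n]] by (simp_all add: emeasure_eq_measure)
  have X_cont: "continuous_on UNIV (X n)" for n
    unfolding X_def by (intro continuous_on_vec_lambda continuous_intros)
  have X_meas: "X n \<in> borel_measurable (uniform_measure M (A m))" for n m
    using borel_measurable_continuous_onI[OF X_cont] M(2) by (simp cong: measurable_cong_sets)
  have \<mu>_prob: "prob_space (\<mu> n)" for n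
    unfolding \<mu>_def by (intro prob_space.prob_space_distr prob_space_uniform_measure em X_meas)
  have \<mu>_sets: "sets (\<mu> n) = sets borel" for n
    unfolding \<mu>_def by simp
  have neg: "AE y in M. \<forall>i. y $ i \<le> 0"
  proof -
    have "AE y in M. y \<in> {y. y $ i \<le> 0}" for i
      using GM(2)[of i 0] prob_eq_1[OF meas(1), of i 0] by (simp add: neg_exp_evd_margin[OF G])
    then show ?thesis
      by (subst AE_all_countable) simp
  qed
  have bound: "AE x in \<mu> n. \<forall>i. \<bar>x $ i\<bar> < 3" for n
  proof -
    have "AE y in M. \<forall>i. \<bar>X n y $ i\<bar> < 3"
      using neg
    proof eventually_elim
      case (elim y)
      then have "Suc n * y $ i \<le> 0" for i
        by (intro mult_nonneg_nonpos) auto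
      then show ?case
        unfolding X_def by (auto simp: abs_less_iff max_def not_le intro: le_less_trans)
    qed
    then have "AE y in uniform_measure M (A n). \<forall>i. \<bar>X n y $ i\<bar> < 3"
      by (intro AE_uniform_measureI A) auto
    moreover have "{x :: real ^ 'n. \<forall>i. \<bar>x $ i\<bar> < 3} \<in> sets borel"
    proof -
      have "(\<Inter>i. {x :: real ^ 'n. \<bar>x $ i\<bar> < 3}) \<in> sets borel"
        by (intro sets.finite_INT borel_open open_Collect_less continuous_intros) auto
      moreover have "(\<Inter>i. {x :: real ^ 'n. \<bar>x $ i\<bar> < 3}) = {x. \<forall>i. \<bar>x $ i\<bar> < 3}"
        by auto
      ultimately show ?thesis by simp
    qed
    ultimately show ?thesis
      unfolding \<mu>_def by (subst AE_distr_iff[OF X_meas]) auto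
  qed
  have \<mu>_df: "measure (\<mu> n) {..x} = 1 - (Suc n * (1 - G (x /\<^sub>R Suc n))) / (Suc n * (1 - G (x0 /\<^sub>R Suc n)))"
    if "x0 \<le> x" for n x
  proof -
    have "X n -` {..x} \<inter> space (uniform_measure M (A n)) = {..x /\<^sub>R Suc n}"
    proof -
      have "- 2 \<le> x $ i" for i
        using that x0(2)[of i] unfolding less_eq_vec_def by (smt (verit))
      then show ?thesis
        using meas(4) unfolding X_def by (auto simp: less_eq_vec_def field_simps)
    qed
    then have "measure (\<mu> n) {..x} = measure (uniform_measure M (A n)) {..x /\<^sub>R Suc n}"
      unfolding \<mu>_def by (subst measure_distr[OF X_meas]) (auto simp: sets_atMost_vec)
    also have "\<dots> = prob (A n \<inter> {..x /\<^sub>R Suc n}) / prob (A n)"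
      by (intro measure_uniform_measure em meas)
    also have "A n \<inter> {..x /\<^sub>R Suc n} = {..x /\<^sub>R Suc n} - {..x0 /\<^sub>R Suc n}"
      unfolding A_def using meas(4) by auto
    also have "prob ({..x /\<^sub>R Suc n} - {..x0 /\<^sub>R Suc n}) = G (x /\<^sub>R Suc n) - G (x0 /\<^sub>R Suc n)"
    proof -
      have "x0 /\<^sub>R Suc n \<le> x /\<^sub>R Suc n"
        using that unfolding less_eq_vec_def by (simp add: divide_right_mono)
      then have "{..x0 /\<^sub>R Suc n} \<subseteq> {..x /\<^sub>R Suc n}"
        by auto
      then show ?thesis
        unfolding GM by (intro finite_measure_Diff meas)
    qed
    also have "(G (x /\<^sub>R Suc n) - G (x0 /\<^sub>R Suc n)) / prob (A n)
        = 1 - (1 - G (x /\<^sub>R Suc n)) / (1 - G (x0 /\<^sub>R Suc n))"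
      using pos[of n] unfolding prob_A by (simp add: field_simps)
    finally show ?thesis
      by simp
  qed
  have lim: "(\<lambda>n. measure (\<mu> n) {..x}) \<longlonglongrightarrow> 1 + ln (G x)" if "x0 \<le> x" for x
  proof -
    have "(\<lambda>n. 1 - (Suc n * (1 - G (x /\<^sub>R Suc n))) / (Suc n * (1 - G (x0 /\<^sub>R Suc n))))
        \<longlonglongrightarrow> 1 - (- ln (G x)) / (- ln (G x0))"
      by (intro tendsto_diff tendsto_const tendsto_divide neg_exp_evd_tendsto[OF G, THEN LIMSEQ_Suc])
        (simp add: lnx0)
    then show ?thesis
      unfolding \<mu>_df[OF that] by (simp add: lnx0)
  qed
  have cont: "(\<lambda>k. 1 + ln (G (\<chi> i. x $ i + 1 / Suc k))) \<longlonglongrightarrow> 1 + ln (G x)" for x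
  proof (intro tendsto_add tendsto_const tendsto_ln continuous_neg_exp_evd[OF G])
    fix i
    have "(\<lambda>k. x $ i + inverse (real (Suc k))) \<longlonglongrightarrow> x $ i + 0"
      by (intro tendsto_intros LIMSEQ_inverse_real_of_nat)
    then show "(\<lambda>k. (\<chi> i. x $ i + 1 / Suc k) $ i) \<longlonglongrightarrow> x $ i"
      by (simp add: inverse_eq_divide)
  next
    show "G x \<noteq> 0"
      using neg_exp_evd_pos[OF G, of x] by simp
  qed
  obtain W where "multi_df W" "\<And>x. x0 \<le> x \<Longrightarrow> W x = 1 + ln (G x)"
    by (rule multi_df_limit[where K = "\<lambda>x. 1 + ln (G x)", OF \<mu>_prob \<mu>_sets _ bound lim cont]) auto
  moreover have "G x0 < 1"
    using s(3) unfolding x0_def by simp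
  ultimately show thesis
    using that x0(1) by blast
qed

lemma gpd_ultimately_uniform_exists:
  fixes G :: "real ^ 'n::finite \<Rightarrow> real"
  assumes G: "neg_exp_evd G"
  obtains W x0 where "gpd_ultimately_uniform W" "\<And>i. x0 $ i < 0" "\<And>x. x0 \<le> x \<Longrightarrow> W x = 1 + ln (G x)"
proof -
  have df: "multi_df G" and evd: "evd G"
    using G unfolding neg_exp_evd_def evd_def by auto
  obtain W x0 where W: "multi_df W" and x0: "\<And>i. x0 $ i < 0" "G x0 < 1"
    and tail: "\<And>x. x0 \<le> x \<Longrightarrow> W x = 1 + ln (G x)"
    using multi_df_one_plus_ln[OF G] by metis
  have gp: "gp_tail W G S" if "S \<subseteq> {x0..}" for S
    unfolding gp_tail_def using tail neg_exp_evd_pos[OF G] that by auto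
  have "margin W i t = 1 + t" if t: "x0 $ i \<le> t" "t \<le> 0" for i t
  proof -
    let ?x = "\<lambda>s. (\<chi> j. if j = i then t else s) :: real ^ 'n"
    have "((\<lambda>s. 1 + ln (G (?x s))) \<longlongrightarrow> 1 + ln (margin G i t)) at_top"
      by (intro tendsto_intros tendsto_margin' df) (simp add: neg_exp_evd_margin[OF G])
    \<comment> \<open>The margin is a limit for \<open>s\<close> tending to infinity, so the formula
      for \<open>W\<close> is used beyond the box \<open>{x0..0}\<close>.\<close>
    moreover have "\<forall>\<^sub>F s in at_top. 1 + ln (G (?x s)) = W (?x s)"
      using eventually_ge_at_top[of 0]
    proof eventually_elim
      case (elim s)
      have "x0 \<le> ?x s"
        using elim t x0(1) unfolding less_eq_vec_def by (auto intro: order_trans less_imp_le)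
      then show ?case
        by (simp add: tail)
    qed
    ultimately have "((\<lambda>s. W (?x s)) \<longlongrightarrow> 1 + ln (margin G i t)) at_top"
      by (rule Lim_transform_eventually)
    from tendsto_unique[OF _ tendsto_margin'[OF W] this] show ?thesis
      using t by (simp add: neg_exp_evd_margin[OF G])
  qed
  then have "gpd_ultimately_uniform W"
    unfolding gpd_ultimately_uniform_def gpd_def
    using W evd x0 gp G unfolding neg_exp_evd_def
    by (intro conjI exI[of _ G] exI[of _ x0]) auto
  with x0(1) tail that show thesis
    by blast
qed

section \<open>From the copula expansion to the domain of attraction\<close>

text \<open>At \<open>y = 1 - v / n\<close> the error term is at most
  \<open>\<epsilon> * N v / n\<close>, and \<open>ln G\<close> at \<open>- v / n\<close> is
  \<open>ln (G (- v)) / n\<close>. Multiplication by \<open>n\<close> turns the expansion into the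
  rate of \<open>1 - C\<close>.\<close>

lemma copula_power_limit_of_expansion:
  fixes C W G N :: "real ^ 'n::finite \<Rightarrow> real"
  assumes C: "copula C" and G: "neg_exp_evd G" and N: "is_norm N"
    and x0: "\<And>i. x0 $ i < 0" and tail: "gp_tail W G {x0..0}"
    and expansion: "\<forall>\<epsilon>>0. \<exists>\<delta>>0. \<forall>y\<in>{0..1}. N (y - 1) \<le> \<delta> \<longrightarrow>
           \<bar>C y - W (y - 1)\<bar> \<le> \<epsilon> * N (y - 1)"
    and v: "\<And>i. 0 \<le> v $ i"
  shows "(\<lambda>n. C (1 - v /\<^sub>R n) ^ n) \<longlonglongrightarrow> G (- v)"
proof -
  have df: "multi_df C"
    using C by (simp add: copula_def)
  have small: "\<forall>\<^sub>F n :: nat in sequentially. v $ i * inverse (real n) < e" if "0 < e" for i e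
    using that tendsto_mult[OF tendsto_const[of "v $ i"] LIMSEQ_inverse_real_of_nat[THEN LIMSEQ_imp_Suc]]
    by (intro order_tendstoD(2)) auto
  have "\<forall>\<^sub>F n :: nat in sequentially. \<forall>i\<in>UNIV. v $ i * inverse (real n) < 1 \<and> v $ i * inverse (real n) < - x0 $ i"
    using x0 by (intro eventually_ball_finite ballI eventually_conj small) auto
  then have ev: "\<forall>\<^sub>F n :: nat in sequentially. 1 - v /\<^sub>R n \<in> {0..1} \<and> - (v /\<^sub>R n) \<in> {x0..0}"
  proof eventually_elim
    case (elim n)
    have "0 \<le> inverse (real n) * v $ i" "inverse (real n) * v $ i \<le> 1" "inverse (real n) * v $ i \<le> - x0 $ i" for i
      using elim v[of i] by (auto simp: mult.commute less_imp_le)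
    then show ?case
      by (auto simp: less_eq_vec_def le_minus_iff)
  qed
  have scale: "N (- (v /\<^sub>R n)) = N v / n" for n :: nat
  proof -
    have "N (c *\<^sub>R v) = \<bar>c\<bar> * N v" for c
      using N unfolding is_norm_def by blast
    from this[of "- inverse (real n)"] show ?thesis
      by (simp add: divide_inverse_commute)
  qed
  \<comment> \<open>\<open>is_norm\<close> does not list nonnegativity; it follows from the triangle
    inequality for \<open>v\<close> and \<open>- v\<close>.\<close>
  have N0: "0 \<le> N v"
  proof -
    have "N 0 \<le> N v + N (- 1 *\<^sub>R v)" "N 0 = 0" "N (- 1 *\<^sub>R v) = N v"
      using N unfolding is_norm_def by (metis add.right_inverse scaleR_minus1_left, metis,
          metis abs_minus abs_one mult_1)
    then show ?thesis by linarith
  qed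
  have "(\<lambda>n. n * (1 - C (1 - v /\<^sub>R n))) \<longlonglongrightarrow> - ln (G (- v))"
  proof (rule tendstoI)
    fix e :: real assume e: "0 < e"
    \<comment> \<open>The summand 1 keeps the denominator positive when
      \<open>N v = 0\<close>.\<close>
    define \<epsilon> where "\<epsilon> = e / (2 * (N v + 1))"
    have "e * N v < e * (2 * (N v + 1))"
      using e N0 by (intro mult_strict_left_mono) auto
    then have \<epsilon>: "0 < \<epsilon>" "\<epsilon> * N v < e"
      unfolding \<epsilon>_def using e N0 by (simp_all add: pos_divide_less_eq)
    obtain \<delta> where \<delta>: "0 < \<delta>" "\<forall>y\<in>{0..1}. N (y - 1) \<le> \<delta> \<longrightarrow> \<bar>C y - W (y - 1)\<bar> \<le> \<epsilon> * N (y - 1)"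
      using expansion \<epsilon>(1) by blast
    have "(\<lambda>n. N v * inverse (real n)) \<longlonglongrightarrow> N v * 0"
      by (intro tendsto_intros LIMSEQ_inverse_real_of_nat[THEN LIMSEQ_imp_Suc])
    then have "\<forall>\<^sub>F n :: nat in sequentially. N v * inverse (real n) < \<delta>"
      using \<delta>(1) by (intro order_tendstoD(2)) auto
    then show "\<forall>\<^sub>F n in sequentially. dist (n * (1 - C (1 - v /\<^sub>R n))) (- ln (G (- v))) < e"
      using ev eventually_gt_at_top[of 0]
    proof eventually_elim
      case (elim n)
      have "\<bar>C (1 - v /\<^sub>R n) - W (- (v /\<^sub>R n))\<bar> \<le> \<epsilon> * (N v / n)"
        using \<delta>(2)[rule_format, of "1 - v /\<^sub>R n"] elim by (simp add: scale divide_inverse)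
      also have "W (- (v /\<^sub>R n)) = 1 + ln (G ((- v) /\<^sub>R n))"
        using tail elim unfolding gp_tail_def by simp
      also have "\<dots> = 1 + ln (G (- v)) / n"
        using elim by (subst neg_exp_evd_ln_scale[OF G]) auto
      finally have "n * \<bar>C (1 - v /\<^sub>R n) - (1 + ln (G (- v)) / n)\<bar> \<le> n * (\<epsilon> * (N v / n))"
        by (intro mult_left_mono) auto
      also have "\<dots> = \<epsilon> * N v"
        using elim by simp
      also have "n * \<bar>C (1 - v /\<^sub>R n) - (1 + ln (G (- v)) / n)\<bar>
          = \<bar>n * (C (1 - v /\<^sub>R n) - (1 + ln (G (- v)) / n))\<bar>"
        by (simp add: abs_mult)
      also have "n * (C (1 - v /\<^sub>R n) - (1 + ln (G (- v)) / n)) = - (n * (1 - C (1 - v /\<^sub>R n)) - - ln (G (- v)))"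
        using elim by (simp add: field_simps)
      finally show ?case
        using \<epsilon>(2) unfolding dist_real_def by linarith
    qed
  qed
  then have "(\<lambda>n. C (1 - v /\<^sub>R n) ^ n) \<longlonglongrightarrow> exp (- (- ln (G (- v))))"
    by (intro tendsto_power_exp multi_df_nonneg[OF df] multi_df_le_1[OF df])
  then show ?thesis
    using neg_exp_evd_pos[OF G, of "- v"] by simp
qed

text \<open>
  The random vector with components \<open>q i (exp (Y $ i))\<close>, where \<open>q i\<close> is the quantile function
  of \<open>g i\<close> and \<open>Y\<close> has distribution function \<open>G\<close>.
\<close>

lemma multi_df_marginal_transform:
  fixes G :: "real ^ 'n::finite \<Rightarrow> real"
  assumes G: "neg_exp_evd G" and g: "\<And>i. univ_df (g i)"
  shows "multi_df (\<lambda>x. if \<forall>i. 0 < g i (x $ i) then G (\<chi> i. ln (g i (x $ i))) else 0)"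
proof -
  have df: "multi_df G"
    using G unfolding neg_exp_evd_def evd_def by auto
  obtain M where M: "prob_space M" "sets M = sets borel"
    and GM: "\<And>x. G x = measure M {..x}" "\<And>i t. margin G i t = measure M {y. y $ i \<le> t}"
    using multi_dfE[OF df] by metis
  interpret prob_space M by fact
  note meas = measure_Collect_le_nth[OF M(2)]
  \<comment> \<open>A quantile of level \<open>exp t\<close> is meaningful for levels inside the
    open unit interval, that is for \<open>t < 0\<close>; the default 0 is met on a null set
    only.\<close>
  define q where "q i t = (if t < 0 then Inf {x. exp t \<le> g i x} else 0)" for i t
  have q: "q i t \<le> x \<longleftrightarrow> exp t \<le> g i x" if "t < 0" for i t x
    using right_continuous_mono.pseudoinverse[OF right_continuous_mono_univ_df[OF g], of "exp t" i x]
      that by (simp add: q_def)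
  have q_meas: "q i \<in> borel_measurable borel" for i
    unfolding borel_measurable_iff_le
  proof
    fix x
    have "q i t \<le> x \<longleftrightarrow> t < 0 \<and> exp t \<le> g i x \<or> 0 \<le> t \<and> 0 \<le> x" for t
    proof (cases "t < 0")
      case True
      then show ?thesis using q[OF True, of i x] by simp
    next
      case False
      then show ?thesis by (simp add: q_def)
    qed
    then have "{t. q i t \<le> x} = {t. t < 0 \<and> exp t \<le> g i x} \<union> {t. 0 \<le> t \<and> 0 \<le> x}"
      by blast
    moreover have "{t. t < 0 \<and> exp t \<le> g i x} \<in> sets borel" "{t :: real. 0 \<le> t \<and> 0 \<le> x} \<in> sets borel"
      by measurable
    ultimately show "{t \<in> space borel. q i t \<le> x} \<in> sets borel"
      by simp
  qed
  define Z :: "real ^ 'n \<Rightarrow> real ^ 'n" where "Z y = (\<chi> i. q i (y $ i))" for y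
  have Z_meas: "Z \<in> borel_measurable M"
  proof -
    have "(\<lambda>y. Z y \<bullet> b) \<in> borel_measurable borel" if basis: "b \<in> Basis" for b
    proof -
      obtain i where b: "b = axis i 1"
        using basis unfolding Basis_vec_def by auto
      have "(\<lambda>y. q i (y $ i)) \<in> borel_measurable borel"
        using q_meas[of i] by measurable
      then show ?thesis
        unfolding b inner_axis Z_def by simp
    qed
    then have "Z \<in> borel_measurable borel"
      by (subst borel_measurable_euclidean_space) auto
    then show ?thesis
      using M(2) by (simp cong: measurable_cong_sets)
  qed
  \<comment> \<open>The margin at 0 only yields \<open>y $ i \<le> 0\<close>. The strict inequality,
    on which the quantile property rests, comes from the levels just below 0.\<close>
  have neg: "AE y in M. \<forall>i. y $ i < 0"
  proof -
    have "AE y in M. y $ i < 0" for i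
    proof -
      have m: "{y. y $ i < 0} \<in> sets M"
        unfolding M(2) by (intro borel_open open_Collect_less continuous_intros)
      have "exp (- inverse (real (Suc k))) \<le> prob {y. y $ i < 0}" for k
      proof -
        have "prob {y. y $ i \<le> - inverse (real (Suc k))} \<le> prob {y. y $ i < 0}"
          by (intro finite_measure_mono m) (auto intro: le_less_trans)
        then show ?thesis
          using GM(2)[of i "- inverse (real (Suc k))"] by (simp add: neg_exp_evd_margin[OF G])
      qed
      moreover have "(\<lambda>k. exp (- inverse (real (Suc k)))) \<longlonglongrightarrow> exp (- 0)"
        by (intro tendsto_intros LIMSEQ_inverse_real_of_nat)
      ultimately have "exp (- 0) \<le> prob {y. y $ i < 0}"
        by (intro LIMSEQ_le_const2) auto
      then have "prob {y. y $ i < 0} = 1"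
        using prob_le_1[of "{y. y $ i < 0}"] by simp
      then show ?thesis
        using prob_eq_1[OF m] by simp
    qed
    then show ?thesis
      by (subst AE_all_countable) simp
  qed
  let ?G' = "\<lambda>x. if \<forall>i. 0 < g i (x $ i) then G (\<chi> i. ln (g i (x $ i))) else 0"
  have "?G' x = measure (distr M borel Z) {..x}" for x
  proof -
    let ?A = "Z -` {..x} \<inter> space M"
    have A: "?A \<in> sets M"
      by (rule measurable_sets[OF Z_meas sets_atMost_vec])
    have "measure (distr M borel Z) {..x} = prob ?A"
      by (rule measure_distr[OF Z_meas sets_atMost_vec])
    also have "\<dots> = ?G' x"
    proof (cases "\<forall>i. 0 < g i (x $ i)")
      case True
      have "prob ?A = prob {..\<chi> i. ln (g i (x $ i))}"
      proof (rule finite_measure_eq_AE[OF _ A meas(3)])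
        show "AE y in M. y \<in> ?A \<longleftrightarrow> y \<in> {..\<chi> i. ln (g i (x $ i))}"
          using neg
        proof eventually_elim
          case (elim y)
          have "exp (y $ i) \<le> g i (x $ i) \<longleftrightarrow> y $ i \<le> ln (g i (x $ i))" for i
            using True by (simp add: ln_ge_iff)
          with elim show ?case
            by (simp add: Z_def less_eq_vec_def q meas(4))
        qed
      qed
      then show ?thesis
        using True by (simp add: GM)
    next
      case False
      then obtain i where "g i (x $ i) \<le> 0"
        by (auto simp: not_less)
      then have i: "\<not> exp t \<le> g i (x $ i)" for t
        using exp_gt_zero[of t] by linarith
      have "prob ?A = prob {}"
      proof (rule finite_measure_eq_AE[OF _ A])
        show "AE y in M. y \<in> ?A \<longleftrightarrow> y \<in> {}"
          using neg
        proof eventually_elim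
          case (elim y)
          then have "\<not> Z y $ i \<le> x $ i"
            using i by (simp add: Z_def q)
          then show ?case
            by (auto simp: less_eq_vec_def)
        qed
      qed simp
      then show ?thesis
        using False by auto
    qed
    finally show ?thesis by simp
  qed
  moreover have "prob_space (distr M borel Z)"
    by (rule prob_space_distr[OF Z_meas])
  ultimately show ?thesis
    unfolding multi_df_def by (intro exI[of _ "distr M borel Z"]) auto
qed

text \<open>The limit is \<open>G\<close> at the vector of \<open>ln (g i (x $ i))\<close>: the
  margins of \<open>F\<close> enter \<open>C\<close> as a sequence \<open>u n\<close> with rates
  \<open>- ln (g i (x $ i))\<close>. Norming constants are taken coordinate by coordinate from the
  margins.\<close>

lemma domain_of_attraction_of_copula:
  fixes F C G :: "real ^ 'n::finite \<Rightarrow> real"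
  assumes F: "multi_df F" and CF: "copula_of C F" and G: "neg_exp_evd G"
    and C: "\<And>v. (\<And>i. 0 \<le> v $ i) \<Longrightarrow> (\<lambda>n. C (1 - v /\<^sub>R n) ^ n) \<longlonglongrightarrow> G (- v)"
    and margins: "\<And>i. \<exists>g. univ_evd g \<and> univ_domain_of_attraction (margin F i) g"
  shows "\<exists>G. evd G \<and> domain_of_attraction F G"
proof -
  have cop: "copula C" and F_eq: "\<And>x. F x = C (\<chi> i. margin F i (x $ i))"
    using CF unfolding copula_of_def by auto
  obtain g where g: "\<And>i. univ_evd (g i)"
    and "\<forall>i. univ_domain_of_attraction (margin F i) (g i)"
    using margins by metis
  then have "\<forall>i. \<exists>a. \<exists>b. (\<forall>n. 0 < a n) \<and> (\<forall>x. (\<lambda>n. margin F i (a n * x + b n) ^ n) \<longlonglongrightarrow> g i x)"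
    unfolding univ_domain_of_attraction_def by blast
  from choice[OF this] obtain a
    where "\<forall>i. \<exists>b. (\<forall>n. 0 < a i n) \<and> (\<forall>x. (\<lambda>n. margin F i (a i n * x + b n) ^ n) \<longlonglongrightarrow> g i x)"
    by blast
  from choice[OF this] obtain b where a: "\<And>i n. 0 < a i n"
    and lim: "\<And>i x. (\<lambda>n. margin F i (a i n * x + b i n) ^ n) \<longlonglongrightarrow> g i x"
    by blast
  have g_df: "univ_df (g i)" for i
    using g unfolding univ_evd_def by auto
  \<comment> \<open>Where some \<open>g i\<close> vanishes the logarithm stands for minus infinity,
    and there \<open>G\<close> is 0; the convention \<open>ln 0 = 0\<close> would give a wrong
    value.\<close>
  define G' where "G' x = (if \<forall>i. 0 < g i (x $ i) then G (\<chi> i. ln (g i (x $ i))) else 0)" for x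
  have G'_df: "multi_df G'"
    unfolding G'_def by (rule multi_df_marginal_transform[OF G g_df])
  define A B :: "nat \<Rightarrow> real ^ 'n" where "A n = (\<chi> i. a i n)" and "B n = (\<chi> i. b i n)" for n
  have A: "0 < A n $ i" for n i
    unfolding A_def by (simp add: a)
  have F_df: "univ_df (margin F i)" for i
    by (rule univ_df_margin[OF F])
  have conv: "(\<lambda>n. F (A n * x + B n) ^ n) \<longlonglongrightarrow> G' x" for x
  proof (cases "\<forall>i. 0 < g i (x $ i)")
    case True
    define u where "u n = (\<chi> i. margin F i (a i n * x $ i + b i n))" for n
    define v where "v = (\<chi> i. - ln (g i (x $ i)))"
    have "(\<lambda>n. n * (1 - u n $ i)) \<longlonglongrightarrow> v $ i" for i
      unfolding u_def v_def using True lim univ_df_nonneg[OF F_df] univ_df_le_1[OF F_df]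
      by (simp add: tendsto_exp_power)
    then have "(\<lambda>n. C (u n) ^ n - C (1 - v /\<^sub>R n) ^ n) \<longlonglongrightarrow> 0"
      by (rule copula_power_diff_tendsto[OF cop])
    moreover have "0 \<le> v $ i" for i
      unfolding v_def using True univ_df_le_1[OF g_df, of i] by simp
    ultimately have "(\<lambda>n. (C (u n) ^ n - C (1 - v /\<^sub>R n) ^ n) + C (1 - v /\<^sub>R n) ^ n) \<longlonglongrightarrow> 0 + G (- v)"
      by (intro tendsto_add C)
    moreover have "- v = (\<chi> i. ln (g i (x $ i)))"
      unfolding v_def by (simp add: vec_eq_iff)
    moreover have "F (A n * x + B n) = C (u n)" for n
      using F_eq[of "A n * x + B n"] by (simp add: A_def B_def u_def)
    ultimately show ?thesis
      using True by (simp add: G'_def)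
  next
    case False
    then obtain i where "\<not> 0 < g i (x $ i)"
      by auto
    then have gi: "g i (x $ i) = 0"
      using univ_df_nonneg[OF g_df, of i "x $ i"] by linarith
    have "(\<lambda>n. F (A n * x + B n) ^ n) \<longlonglongrightarrow> 0"
    proof (rule tendsto_sandwich[where f = "\<lambda>_. 0"])
      show "(\<lambda>n. margin F i (a i n * x $ i + b i n) ^ n) \<longlonglongrightarrow> 0"
        using lim[of i "x $ i"] unfolding gi .
      show "\<forall>\<^sub>F n in sequentially. F (A n * x + B n) ^ n \<le> margin F i (a i n * x $ i + b i n) ^ n"
        using multi_df_le_margin[OF F, of "A n * x + B n" i for n]
        by (intro always_eventually allI power_mono multi_df_nonneg[OF F]) (simp add: A_def B_def)
    qed (use multi_df_nonneg[OF F] in auto)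
    moreover have "G' x = 0"
      unfolding G'_def by (rule if_not_P[OF False])
    ultimately show ?thesis by simp
  qed
  \<comment> \<open>The margins of \<open>G'\<close> need no computation: they and the
    \<open>g i\<close> are limits of the same sequences.\<close>
  have margin_G': "margin G' i = g i" for i
  proof
    fix t
    have "(\<lambda>n. margin F i (A n $ i * t + B n $ i) ^ n) \<longlonglongrightarrow> margin G' i t"
      by (rule domain_of_attraction_margin[OF F G'_df A conv])
    from LIMSEQ_unique[OF this] lim show "margin G' i t = g i t"
      by (simp add: A_def B_def)
  qed
  \<comment> \<open>Stability constants of the separate margins may be put together, since each
    divides its \<open>ln (g i)\<close> by the same \<open>n\<close>, and \<open>G\<close> is stable
    under that common scaling.\<close>
  have "\<exists>c d. (\<forall>i. 0 < c $ i) \<and> (\<forall>x. G' (c * x + d) ^ n = G' x)" if n: "1 \<le> n" for n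
  proof -
    have "\<forall>i. \<exists>c. \<exists>d. 0 < c \<and> (\<forall>x. g i (c * x + d) ^ n = g i x)"
      using g n unfolding univ_evd_def by blast
    from choice[OF this] obtain c where "\<forall>i. \<exists>d. 0 < c i \<and> (\<forall>x. g i (c i * x + d) ^ n = g i x)"
      by blast
    from choice[OF this] obtain d
      where c: "\<And>i. 0 < c i" and stable: "\<And>i x. g i (c i * x + d i) ^ n = g i x"
      by blast
    have pos: "0 < g i (c i * x + d i) \<longleftrightarrow> 0 < g i x" for i x
    proof -
      have "0 < z ^ n \<longleftrightarrow> 0 < z" if "0 \<le> z" for z :: real
        using that n by (cases "z = 0") (auto simp: zero_power)
      from this[OF univ_df_nonneg[OF g_df, of i "c i * x + d i"]] show ?thesis
        by (simp only: stable)
    qed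
    have ln: "ln (g i (c i * x + d i)) = ln (g i x) / n" for i x
    proof -
      have "ln (g i x) = n * ln (g i (c i * x + d i))"
        unfolding stable[of i x, symmetric] by (rule ln_realpow)
      then show ?thesis
        using n by simp
    qed
    have "G' ((\<chi> i. c i) * x + (\<chi> i. d i)) ^ n = G' x" for x
    proof (cases "\<forall>i. 0 < g i (x $ i)")
      case True
      have "(\<chi> i. ln (g i (c i * x $ i + d i))) = (\<chi> i. ln (g i (x $ i))) /\<^sub>R n"
        unfolding ln by (simp add: vec_eq_iff divide_inverse mult.commute)
      then show ?thesis
        using True by (simp add: G'_def pos neg_exp_evd_scale[OF G n])
    next
      case False
      then show ?thesis
        using n by (auto simp: G'_def pos)
    qed
    then show ?thesis
      using c by (intro exI[of _ "\<chi> i. c i"] exI[of _ "\<chi> i. d i"]) simp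
  qed
  moreover have "nondegenerate (margin G' i)" for i
    using g unfolding margin_G' univ_evd_def by auto
  ultimately have "evd G'"
    unfolding evd_def using G'_df by blast
  moreover have "domain_of_attraction F G'"
    unfolding domain_of_attraction_def using A conv by blast
  ultimately show ?thesis
    by blast
qed

section \<open>From the domain of attraction to the copula expansion\<close>

text \<open>The probability integral transform, with density of the range in place of continuity: if
  the probability differed from \<open>u\<close>, some value \<open>g x\<close> would lie strictly
  between them, and monotonicity of \<open>g\<close> would contradict it.\<close>

lemma univ_evd_integral_transform:
  assumes M: "prob_space M" and X: "X \<in> borel_measurable M" and g: "univ_evd g"
    and gX: "\<And>t. g t = measure M {y \<in> space M. X y \<le> t}" and u: "0 \<le> u" "u \<le> 1"
  shows "{y \<in> space M. g (X y) \<le> u} \<in> sets M" "measure M {y \<in> space M. g (X y) \<le> u} = u"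
proof -
  interpret prob_space M by fact
  have df: "univ_df g"
    using g unfolding univ_evd_def by auto
  have g_mono: "g s \<le> g t" if "s \<le> t" for s t
    using univ_df_mono[OF df that] .
  have g_meas: "g \<in> borel_measurable borel"
    by (intro borel_measurable_mono monoI g_mono)
  then have "(\<lambda>y. g (X y)) \<in> borel_measurable M"
    using X by measurable
  then show sets: "{y \<in> space M. g (X y) \<le> u} \<in> sets M"
    by measurable
  have X_sets: "{y \<in> space M. X y \<le> t} \<in> sets M" for t
    using X by measurable
  show "measure M {y \<in> space M. g (X y) \<le> u} = u" (is "?p = u")
  proof (rule ccontr)
    assume "?p \<noteq> u"
    then consider "?p < u" | "u < ?p" by linarith
    then show False
    proof cases
      case 1
      then obtain x where x: "?p < g x" "g x < u"
        using univ_evd_dense_range[OF g _ 1 u(2)] measure_nonneg by blast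
      have "g (X y) \<le> u" if "X y \<le> x" for y
        using g_mono[OF that] x(2) by linarith
      then have "prob {y \<in> space M. X y \<le> x} \<le> ?p"
        by (intro finite_measure_mono sets) auto
      with x show False
        by (simp flip: gX)
    next
      case 2
      then obtain x where x: "u < g x" "g x < ?p"
        using univ_evd_dense_range[OF g u(1) 2] prob_le_1 by blast
      have "X y \<le> x" if "g (X y) \<le> u" for y
        using that x(1) g_mono[of x "X y"] by linarith
      then have "?p \<le> prob {y \<in> space M. X y \<le> x}"
        by (intro finite_measure_mono X_sets) auto
      with x show False
        by (simp flip: gX)
    qed
  qed
qed

text \<open>\<open>H\<close> is the law of the vector with components
  \<open>ln (g i (Y $ i))\<close>, where \<open>Y\<close> has distribution function \<open>G\<close>
  and margins \<open>g i\<close>; the integral transform gives its margins and, at level 0, makes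
  the logarithms meaningful almost surely.\<close>

lemma evd_marginal_transform:
  fixes G :: "real ^ 'n::finite \<Rightarrow> real"
  assumes G: "evd G"
  obtains H where "multi_df H" "\<And>i t. t \<le> 0 \<Longrightarrow> margin H i t = exp t"
    "\<And>x. (\<And>i. 0 < margin G i (x $ i)) \<Longrightarrow> H (\<chi> i. ln (margin G i (x $ i))) = G x"
proof -
  have df: "multi_df G"
    using G unfolding evd_def by auto
  obtain M where M: "prob_space M" "sets M = sets borel"
    and GM: "\<And>x. G x = measure M {..x}" "\<And>i t. margin G i t = measure M {y. y $ i \<le> t}"
    using multi_dfE[OF df] by metis
  interpret prob_space M by fact
  note meas = measure_Collect_le_nth[OF M(2)]
  let ?g = "margin G"
  have g_df: "univ_df (?g i)" for i
    by (rule univ_df_margin[OF df])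
  have nth_meas: "(\<lambda>y. y $ i) \<in> borel_measurable M" for i
    using M(2) by (simp cong: measurable_cong_sets)
  have pit: "{y. ?g i (y $ i) \<le> u} \<in> sets M" "prob {y. ?g i (y $ i) \<le> u} = u"
    if "0 \<le> u" "u \<le> 1" for i u
    using univ_evd_integral_transform[OF M(1) nth_meas univ_evd_margin[OF G] _ that, of i i]
    by (simp_all add: meas(4) GM(2))
  have pos: "AE y in M. \<forall>i. 0 < ?g i (y $ i)"
  proof -
    have "AE y in M. 0 < ?g i (y $ i)" for i
    proof -
      have "AE y in M. y \<notin> {y. ?g i (y $ i) \<le> 0}"
        using pit[of 0 i] prob_eq_0[of "{y. ?g i (y $ i) \<le> 0}"] by simp
      then show ?thesis
        by (simp add: not_le)
    qed
    then show ?thesis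
      by (subst AE_all_countable) simp
  qed
  define T :: "real ^ 'n \<Rightarrow> real ^ 'n" where "T y = (\<chi> i. ln (?g i (y $ i)))" for y
  have g_meas: "?g i \<in> borel_measurable borel" for i
    using univ_df_mono[OF g_df] by (intro borel_measurable_mono monoI) auto
  have T_meas: "T \<in> borel_measurable M"
  proof -
    have "(\<lambda>y. T y \<bullet> b) \<in> borel_measurable borel" if basis: "b \<in> Basis" for b
    proof -
      obtain i where b: "b = axis i 1"
        using basis unfolding Basis_vec_def by auto
      have "(\<lambda>y. ln (?g i (y $ i))) \<in> borel_measurable borel"
        using g_meas[of i] by measurable
      then show ?thesis
        unfolding b inner_axis T_def by simp
    qed
    then have "T \<in> borel_measurable borel"
      by (subst borel_measurable_euclidean_space) auto
    then show ?thesis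
      using M(2) by (simp cong: measurable_cong_sets)
  qed
  define H where "H x = measure (distr M borel T) {..x}" for x
  have prob_T: "prob_space (distr M borel T)"
    by (rule prob_space_distr[OF T_meas])
  have H_df: "multi_df H"
    unfolding multi_df_def H_def using prob_T by (intro exI[of _ "distr M borel T"]) auto
  show thesis
  proof (rule that[OF H_df])
    fix i :: 'n and t :: real assume t: "t \<le> 0"
    have sets: "{y. y $ i \<le> t} \<in> sets borel"
      using meas(1) unfolding M(2) .
    have "margin H i t = measure (distr M borel T) {y. y $ i \<le> t}"
      unfolding H_def by (rule margin_eq_measure[OF prob_T]) simp
    also have "\<dots> = prob (T -` {y. y $ i \<le> t} \<inter> space M)"
      by (rule measure_distr[OF T_meas sets])
    also have "\<dots> = prob {y. ?g i (y $ i) \<le> exp t}"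
    proof (rule finite_measure_eq_AE)
      show "AE y in M. y \<in> T -` {y. y $ i \<le> t} \<inter> space M \<longleftrightarrow> y \<in> {y. ?g i (y $ i) \<le> exp t}"
        using pos
      proof eventually_elim
        case (elim y)
        have "ln (?g i (y $ i)) \<le> t \<longleftrightarrow> ?g i (y $ i) \<le> exp t"
          using elim[rule_format, of i] exp_le_cancel_iff[of "ln (?g i (y $ i))" t] by simp
        then show ?case
          by (simp add: T_def meas(4))
      qed
      show "T -` {y. y $ i \<le> t} \<inter> space M \<in> sets M"
        by (rule measurable_sets[OF T_meas sets])
      show "{y. ?g i (y $ i) \<le> exp t} \<in> sets M"
        using t by (intro pit) auto
    qed
    also have "\<dots> = exp t"
      using t by (intro pit) auto
    finally show "margin H i t = exp t" .
  next
    fix x :: "real ^ 'n" assume x: "\<And>i. 0 < ?g i (x $ i)"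
    \<comment> \<open>\<open>g i\<close> may be flat to the right of \<open>x $ i\<close>, so its
      order is reversed to that of the arguments only almost surely: both events have probability
      \<open>g i (x $ i)\<close> and one contains the other.\<close>
    have ties: "AE y in M. \<forall>i. ?g i (y $ i) \<le> ?g i (x $ i) \<longrightarrow> y $ i \<le> x $ i"
    proof -
      have "AE y in M. ?g i (y $ i) \<le> ?g i (x $ i) \<longrightarrow> y $ i \<le> x $ i" for i
      proof -
        let ?A = "{y. ?g i (y $ i) \<le> ?g i (x $ i)}" and ?B = "{y. y $ i \<le> x $ i}"
        note A = pit[OF univ_df_nonneg[OF g_df] univ_df_le_1[OF g_df], of i i "x $ i"]
        have "?B \<subseteq> ?A"
          using univ_df_mono[OF g_df] by auto
        then have "prob (?A - ?B) = 0"
          using A(2) by (subst finite_measure_Diff[OF A(1) meas(1)]) (auto simp: GM(2))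
        then have "AE y in M. y \<notin> ?A - ?B"
          using prob_eq_0[of "?A - ?B"] A(1) meas(1) by blast
        then show ?thesis
          by eventually_elim auto
      qed
      then show ?thesis
        by (subst AE_all_countable) simp
    qed
    have "H (\<chi> i. ln (?g i (x $ i))) = prob (T -` {..\<chi> i. ln (?g i (x $ i))} \<inter> space M)"
      unfolding H_def by (rule measure_distr[OF T_meas sets_atMost_vec])
    also have "\<dots> = prob {..x}"
    proof (rule finite_measure_eq_AE)
      show "AE y in M. y \<in> T -` {..\<chi> i. ln (?g i (x $ i))} \<inter> space M \<longleftrightarrow> y \<in> {..x}"
        using pos ties
      proof eventually_elim
        case (elim y)
        have "ln (?g i (y $ i)) \<le> ln (?g i (x $ i)) \<longleftrightarrow> y $ i \<le> x $ i" for i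
          using elim x[of i] univ_df_mono[OF g_df, of "y $ i" "x $ i" i] by (auto simp: ln_le_cancel_iff)
        then show ?case
          by (simp add: T_def less_eq_vec_def meas(4))
      qed
    qed (rule measurable_sets[OF T_meas sets_atMost_vec], rule meas)
    finally show "H (\<chi> i. ln (?g i (x $ i))) = G x"
      by (simp add: GM)
  qed
qed

text \<open>The hypothesis yields the limit directly only at vectors \<open>v\<close> with
  components \<open>- ln (g i (x $ i))\<close>. These are dense among the nonnegative vectors, and
  the maps \<open>v \<mapsto> C (1 - v / n) ^ n\<close> are l1-Lipschitz with constant 1 for all
  positive \<open>n\<close>, so the limit extends to every \<open>v\<close>. Max-stability of
  \<open>H\<close> is then read off the limit.\<close>

lemma copula_power_limit_of_domain:
  fixes F C G :: "real ^ 'n::finite \<Rightarrow> real"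
  assumes F: "multi_df F" and CF: "copula_of C F" and G: "evd G" and dom: "domain_of_attraction F G"
  obtains H where "neg_exp_evd H"
    "\<And>v. (\<And>i. 0 \<le> v $ i) \<Longrightarrow> (\<lambda>n. C (1 - v /\<^sub>R n) ^ n) \<longlonglongrightarrow> H (- v)"
proof -
  have cop: "copula C" and F_eq: "\<And>x. F x = C (\<chi> i. margin F i (x $ i))"
    using CF unfolding copula_of_def by auto
  have df: "multi_df C"
    using cop by (simp add: copula_def)
  obtain a b where a: "\<And>n i. 0 < a n $ i" and conv: "\<And>x. (\<lambda>n. F (a n * x + b n) ^ n) \<longlonglongrightarrow> G x"
    using dom unfolding domain_of_attraction_def by blast
  have G_df: "multi_df G"
    using G unfolding evd_def by auto
  obtain H where H: "multi_df H" "\<And>i t. t \<le> 0 \<Longrightarrow> margin H i t = exp t"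
    and HG: "\<And>x. (\<And>i. 0 < margin G i (x $ i)) \<Longrightarrow> H (\<chi> i. ln (margin G i (x $ i))) = G x"
    by (rule evd_marginal_transform[OF G]) blast
  have margin_H: "margin H i t = exp (min t 0)" for i t
    using H by (rule exp_margins)
  have H_Lipschitz: "\<bar>H x - H y\<bar> \<le> (\<Sum>i\<in>UNIV. \<bar>x $ i - y $ i\<bar>)" for x y
    using H by (rule exp_margins_Lipschitz)
  have F_df: "univ_df (margin F i)" for i
    by (rule univ_df_margin[OF F])
  have dense: "(\<lambda>n. C (1 - v /\<^sub>R n) ^ n) \<longlonglongrightarrow> H (- v)"
    if x: "\<And>i. 0 < margin G i (x $ i)" and v: "v = (\<chi> i. - ln (margin G i (x $ i)))" for v x
  proof -
    define u where "u n = (\<chi> i. margin F i (a n $ i * x $ i + b n $ i))" for n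
    have "(\<lambda>n. n * (1 - u n $ i)) \<longlonglongrightarrow> v $ i" for i
      unfolding u_def v
      using tendsto_exp_power[OF univ_df_nonneg[OF F_df] univ_df_le_1[OF F_df]
          domain_of_attraction_margin[OF F G_df a conv] x] by simp
    then have "(\<lambda>n. C (u n) ^ n - C (1 - v /\<^sub>R n) ^ n) \<longlonglongrightarrow> 0"
      by (rule copula_power_diff_tendsto[OF cop])
    moreover have "F (a n * x + b n) = C (u n)" for n
      using F_eq[of "a n * x + b n"] by (simp add: u_def)
    then have "(\<lambda>n. C (u n) ^ n) \<longlonglongrightarrow> G x"
      using conv[of x] by simp
    ultimately have "(\<lambda>n. C (u n) ^ n - (C (u n) ^ n - C (1 - v /\<^sub>R n) ^ n)) \<longlonglongrightarrow> G x - 0"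
      by (intro tendsto_diff)
    moreover have "- v = (\<chi> i. ln (margin G i (x $ i)))"
      unfolding v by (simp add: vec_eq_iff)
    ultimately show ?thesis
      using HG[OF x] by simp
  qed
  have limit: "(\<lambda>n. C (1 - v /\<^sub>R n) ^ n) \<longlonglongrightarrow> H (- v)" if v: "\<And>i. 0 \<le> v $ i" for v
  proof (rule tendstoI)
    fix e :: real assume e: "0 < e"
    \<comment> \<open>An error \<open>\<eta>\<close> in every coordinate adds up to
      \<open>e / 3\<close> in the l1 distance.\<close>
    define \<eta> where "\<eta> = e / (3 * CARD('n))"
    have \<eta>: "0 < \<eta>"
      unfolding \<eta>_def using e by simp
    have "\<exists>x. exp (- (v $ i + \<eta>)) < margin G i x \<and> margin G i x < exp (- v $ i)" for i
      using univ_evd_dense_range[OF univ_evd_margin[OF G], of "exp (- (v $ i + \<eta>))" "exp (- v $ i)" i]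
        v[of i] \<eta> by (metis exp_ge_zero exp_le_one_iff exp_less_cancel_iff less_add_same_cancel1
          neg_le_0_iff_le neg_less_iff_less)
    then obtain x where x: "\<And>i. exp (- (v $ i + \<eta>)) < margin G i (x i)" "\<And>i. margin G i (x i) < exp (- v $ i)"
      by metis
    define w where "w = (\<chi> i. - ln (margin G i (x i)))"
    have x_pos: "0 < margin G i (x i)" for i
      using x(1)[of i] exp_gt_zero[of "- (v $ i + \<eta>)"] by linarith
    have w: "\<bar>w $ i - v $ i\<bar> \<le> \<eta>" for i
    proof -
      have "- (v $ i + \<eta>) < ln (margin G i (x i))" "ln (margin G i (x i)) < - v $ i"
        using x[of i] x_pos[of i] ln_less_cancel_iff[of "exp (- (v $ i + \<eta>))" "margin G i (x i)"]
          ln_less_cancel_iff[of "margin G i (x i)" "exp (- v $ i)"] by simp_all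
      then show ?thesis
        unfolding w_def by simp
    qed
    have dist_vw: "(\<Sum>i\<in>UNIV. \<bar>w $ i - v $ i\<bar>) \<le> e / 3"
    proof -
      have "(\<Sum>i\<in>UNIV. \<bar>w $ i - v $ i\<bar>) \<le> (\<Sum>i\<in>(UNIV :: 'n set). \<eta>)"
        by (intro sum_mono w)
      also have "\<dots> = e / 3"
        unfolding \<eta>_def by simp
      finally show ?thesis .
    qed
    have "(\<lambda>n. C (1 - w /\<^sub>R n) ^ n) \<longlonglongrightarrow> H (- w)"
      using x_pos by (intro dense[of "\<chi> i. x i"]) (auto simp: w_def)
    then have "\<forall>\<^sub>F n in sequentially. dist (C (1 - w /\<^sub>R n) ^ n) (H (- w)) < e / 3"
      using e by (intro tendstoD) auto
    then show "\<forall>\<^sub>F n in sequentially. dist (C (1 - v /\<^sub>R n) ^ n) (H (- v)) < e"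
      using eventually_gt_at_top[of 0]
    proof eventually_elim
      case (elim n)
      have "\<bar>C (1 - w /\<^sub>R n) ^ n - C (1 - v /\<^sub>R n) ^ n\<bar> \<le> n * \<bar>C (1 - w /\<^sub>R n) - C (1 - v /\<^sub>R n)\<bar>"
        by (intro abs_power_diff_le multi_df_nonneg[OF df] multi_df_le_1[OF df])
      also have "\<dots> \<le> n * (\<Sum>i\<in>UNIV. \<bar>(1 - w /\<^sub>R n) $ i - (1 - v /\<^sub>R n) $ i\<bar>)"
        by (intro mult_left_mono copula_Lipschitz cop) simp
      also have "(\<Sum>i\<in>UNIV. \<bar>(1 - w /\<^sub>R n) $ i - (1 - v /\<^sub>R n) $ i\<bar>) = (\<Sum>i\<in>UNIV. inverse n * \<bar>w $ i - v $ i\<bar>)"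
      proof (intro sum.cong refl)
        fix i
        have "(1 - w /\<^sub>R n) $ i - (1 - v /\<^sub>R n) $ i = - (inverse n * (w $ i - v $ i))"
          by (simp add: algebra_simps)
        then show "\<bar>(1 - w /\<^sub>R n) $ i - (1 - v /\<^sub>R n) $ i\<bar> = inverse n * \<bar>w $ i - v $ i\<bar>"
          by (simp only: abs_minus_cancel abs_mult) simp
      qed
      also have "n * \<dots> = (\<Sum>i\<in>UNIV. \<bar>w $ i - v $ i\<bar>)"
        using elim by (simp flip: sum_distrib_left)
      finally have "\<bar>C (1 - w /\<^sub>R n) ^ n - C (1 - v /\<^sub>R n) ^ n\<bar> \<le> e / 3"
        using dist_vw by linarith
      moreover have "\<bar>H (- w) - H (- v)\<bar> \<le> (\<Sum>i\<in>UNIV. \<bar>w $ i - v $ i\<bar>)"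
        using H_Lipschitz[of "- w" "- v"] by (simp add: abs_minus_commute)
      ultimately show ?case
        using elim(1) dist_vw unfolding dist_real_def by linarith
    qed
  qed
  have scale: "H (x /\<^sub>R k) ^ k = H x" if k: "1 \<le> k" for k :: nat and x
  proof -
    \<comment> \<open>The limit is known for nonnegative \<open>v\<close> only; positive coordinates
      of \<open>x\<close> may be cut off at 0 because the margins of \<open>H\<close> are constant
      there.\<close>
    have min: "H x = H (\<chi> i. min (x $ i) 0)" for x
    proof -
      have "\<bar>H x - H (\<chi> i. min (x $ i) 0)\<bar> \<le> 0"
        using multi_df_Lipschitz[OF H(1), of x "\<chi> i. min (x $ i) 0"] by (simp add: margin_H)
      then show ?thesis by simp
    qed
    define v where "v = (\<chi> i. - min (x $ i) 0)"
    have v: "0 \<le> v $ i" for i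
      unfolding v_def by simp
    have "(\<lambda>m. C (1 - (v /\<^sub>R k) /\<^sub>R m) ^ m) \<longlonglongrightarrow> H (- (v /\<^sub>R k))"
      using v by (intro limit) simp
    then have 1: "(\<lambda>m. (C (1 - (v /\<^sub>R k) /\<^sub>R m) ^ m) ^ k) \<longlonglongrightarrow> H (- (v /\<^sub>R k)) ^ k"
      by (rule tendsto_power)
    \<comment> \<open>Along multiples of \<open>k\<close> the same sequence is read twice: as the
      limit at \<open>v\<close>, and as the \<open>k\<close>-th power of the sequence at
      \<open>v / k\<close>.\<close>
    have "filterlim (\<lambda>m. k * m) sequentially sequentially"
      using k by (intro filterlim_subseq) (simp add: strict_mono_def)
    from filterlim_compose[OF limit[OF v] this]
    have "(\<lambda>m. C (1 - v /\<^sub>R (k * m)) ^ (k * m)) \<longlonglongrightarrow> H (- v)"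
      by simp
    moreover have "C (1 - v /\<^sub>R (k * m)) ^ (k * m) = (C (1 - (v /\<^sub>R k) /\<^sub>R m) ^ m) ^ k" for m
      by (simp add: mult.commute flip: power_mult)
    ultimately have "H (- v) = H (- (v /\<^sub>R k)) ^ k"
      using LIMSEQ_unique[OF 1] by simp
    also have "- (v /\<^sub>R k) = (\<chi> i. min ((x /\<^sub>R k) $ i) 0)"
    proof -
      have "inverse (real k) * min (x $ i) 0 = min (inverse (real k) * x $ i) 0" for i
        using k by (simp add: min_mult_distrib_left)
      then show ?thesis
        unfolding v_def by (simp add: vec_eq_iff)
    qed
    also have "- v = (\<chi> i. min (x $ i) 0)"
      unfolding v_def by (simp add: vec_eq_iff)
    finally show ?thesis
      using min[of x] min[of "x /\<^sub>R k"] by simp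
  qed
  have "evd H"
    unfolding evd_def
  proof (intro conjI allI impI H)
    fix i
    have "margin H i (- 1) = exp (- 1)"
      by (simp add: margin_H)
    moreover have "exp (- 1) \<noteq> (1 :: real)" "exp (- 1) \<noteq> (0 :: real)"
      by simp_all
    ultimately show "nondegenerate (margin H i)"
      unfolding nondegenerate_def by metis
  next
    fix k :: nat assume k: "1 \<le> k"
    have "(\<chi> i. inverse (real k)) * x + 0 = x /\<^sub>R k" for x :: "real ^ 'n"
      by (simp add: vec_eq_iff)
    then show "\<exists>c d. (\<forall>i. 0 < c $ i) \<and> (\<forall>x. H (c * x + d) ^ k = H x)"
      using k scale[OF k] by (intro exI[of _ "\<chi> i. inverse (real k)"] exI[of _ 0]) simp
  qed
  then have "neg_exp_evd H"
    unfolding neg_exp_evd_def using H(2) by blast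
  with limit that show thesis
    by blast
qed

text \<open>This carries an o-term from the l1 norm over to \<open>N\<close>. As a convex function
  \<open>N\<close> is continuous, so it has a positive minimum on the Euclidean unit sphere.\<close>

lemma is_norm_lower_bound:
  fixes N :: "real ^ 'n::finite \<Rightarrow> real"
  assumes "is_norm N"
  obtains c where "0 < c" "\<And>v. c * (\<Sum>i\<in>UNIV. \<bar>v $ i\<bar>) \<le> N v"
proof -
  have zero: "\<And>x. N x = 0 \<longleftrightarrow> x = 0" and scale: "\<And>c x. N (c *\<^sub>R x) = \<bar>c\<bar> * N x"
    and add: "\<And>x y. N (x + y) \<le> N x + N y"
    using assms unfolding is_norm_def by auto
  have nonneg: "0 \<le> N x" for x
    using add[of x "- 1 *\<^sub>R x"] scale[of "- 1" x] zero[of 0] by simp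
  have "convex_on UNIV N"
  proof (rule convex_onI)
    fix t :: real and x y assume t: "0 < t" "t < 1"
    show "N ((1 - t) *\<^sub>R x + t *\<^sub>R y) \<le> (1 - t) * N x + t * N y"
      using add[of "(1 - t) *\<^sub>R x" "t *\<^sub>R y"] t by (simp add: scale)
  qed simp
  then have "continuous_on UNIV N"
    by (intro convex_on_continuous) auto
  then have "continuous_on (sphere 0 1) N"
    by (rule continuous_on_subset) simp
  moreover have "axis undefined 1 \<in> sphere (0 :: real ^ 'n) 1"
    by simp
  then have "sphere (0 :: real ^ 'n) 1 \<noteq> {}"
    by blast
  ultimately obtain z where z: "z \<in> sphere 0 1" "\<And>x. x \<in> sphere 0 1 \<Longrightarrow> N z \<le> N x"
    using continuous_attains_inf[OF compact_sphere] by blast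
  have "z \<noteq> 0"
    using z(1) by auto
  then have Nz: "0 < N z"
    using nonneg[of z] zero[of z] by linarith
  have bound: "N z * norm v \<le> N v" for v
  proof (cases "v = 0")
    case False
    then have "N z \<le> N (inverse (norm v) *\<^sub>R v)"
      by (intro z) simp
    also have "\<dots> = inverse (norm v) * N v"
      by (simp add: scale)
    finally have "norm v * N z \<le> norm v * (inverse (norm v) * N v)"
      by (intro mult_left_mono) auto
    moreover have "norm v * (inverse (norm v) * N v) = N v"
      using False by (simp flip: mult.assoc)
    ultimately show ?thesis
      by (simp only: mult.commute)
  qed (simp add: nonneg)
  show thesis
  proof (rule that)
    show "0 < N z / CARD('n)"
      using Nz by simp
    fix v :: "real ^ 'n"
    have "(\<Sum>i\<in>UNIV. \<bar>v $ i\<bar>) \<le> (\<Sum>i\<in>(UNIV :: 'n set). norm v)"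
      by (intro sum_mono component_le_norm_cart)
    then have "N z / CARD('n) * (\<Sum>i\<in>UNIV. \<bar>v $ i\<bar>) \<le> N z / CARD('n) * (CARD('n) * norm v)"
      using Nz by (intro mult_left_mono) auto
    also have "\<dots> = N z * norm v"
      by simp
    also have "\<dots> \<le> N v"
      by (rule bound)
    finally show "N z / CARD('n) * (\<Sum>i\<in>UNIV. \<bar>v $ i\<bar>) \<le> N v" .
  qed
qed

text \<open>
  A sequence of counterexamples \<open>y k\<close> is rescaled by the integers \<open>m k = \<lfloor>1 / r k\<rfloor>\<close>, where \<open>r k\<close>
  is the \<open>l\<^sub>1\<close>-distance to \<open>1\<close>; compactness reduces the claim to the limit at a single point.
\<close>

lemma copula_expansion:
  fixes C G :: "real ^ 'n::finite \<Rightarrow> real"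
  assumes C: "copula C" and G: "neg_exp_evd G"
    and lim: "\<And>v. (\<And>i. 0 \<le> v $ i) \<Longrightarrow> (\<lambda>n. C (1 - v /\<^sub>R n) ^ n) \<longlonglongrightarrow> G (- v)"
    and \<epsilon>: "0 < \<epsilon>"
  shows "\<exists>\<delta>>0. \<forall>y\<in>{0..1}. (\<Sum>i\<in>UNIV. \<bar>(y - 1) $ i\<bar>) \<le> \<delta> \<longrightarrow>
    \<bar>C y - (1 + ln (G (y - 1)))\<bar> \<le> \<epsilon> * (\<Sum>i\<in>UNIV. \<bar>(y - 1) $ i\<bar>)"
proof (rule ccontr)
  assume contra: "\<not> ?thesis"
  have df: "multi_df C"
    using C by (simp add: copula_def)
  define l1 :: "real ^ 'n \<Rightarrow> real" where "l1 x = (\<Sum>i\<in>UNIV. \<bar>x $ i\<bar>)" for x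
  have "\<exists>y\<in>{0..1}. l1 (y - 1) \<le> inverse (Suc k) \<and>
      \<epsilon> * l1 (y - 1) < \<bar>C y - (1 + ln (G (y - 1)))\<bar>" for k
  proof -
    have "0 < inverse (real (Suc k))"
      by simp
    with contra show ?thesis
      unfolding l1_def[symmetric] by (meson not_le)
  qed
  then obtain y where y: "\<And>k. y k \<in> {0..1}" "\<And>k. l1 (y k - 1) \<le> inverse (Suc k)"
    "\<And>k. \<epsilon> * l1 (y k - 1) < \<bar>C (y k) - (1 + ln (G (y k - 1)))\<bar>"
    by metis
  define r where "r k = l1 (y k - 1)" for k
  have y01: "0 \<le> y k $ i" "y k $ i \<le> 1" for k i
    using y(1)[of k] by (auto simp: less_eq_vec_def)
  have r_sum: "r k = (\<Sum>i\<in>UNIV. 1 - y k $ i)" for k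
    unfolding r_def l1_def using y01 by (intro sum.cong) auto
  \<comment> \<open>At \<open>y = 1\<close> both sides of the expansion equal 1, so no
    counterexample sits there.\<close>
  have "r k \<noteq> 0" for k
  proof
    assume "r k = 0"
    then have "\<forall>i. 1 - y k $ i = 0"
      unfolding r_sum using y01 by (subst (asm) sum_nonneg_eq_0_iff) auto
    then have "y k = 1"
      by (simp add: vec_eq_iff)
    moreover have "C 1 = 1"
      using one_minus_multi_df_le[OF df, of 1] multi_df_le_1[OF df, of 1] by (simp add: copula_margin[OF C])
    moreover have "G 0 = 1"
    proof -
      have G_df: "multi_df G"
        using G unfolding neg_exp_evd_def evd_def by auto
      show ?thesis
        using one_minus_multi_df_le[OF G_df, of 0] multi_df_le_1[OF G_df, of 0]
        by (simp add: neg_exp_evd_margin[OF G])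
    qed
    ultimately show False
      using y(3)[of k] by (simp add: l1_def)
  qed
  moreover have "0 \<le> r k" for k
    unfolding r_def l1_def by (intro sum_nonneg) simp
  ultimately have r_pos: "0 < r k" for k
    by (metis order_le_less)
  have r_le: "r k \<le> inverse (Suc k)" for k
    unfolding r_def by (rule y)
  define m where "m k = nat \<lfloor>inverse (r k)\<rfloor>" for k
  have m_ge: "Suc k \<le> m k" for k
  proof -
    have "real (Suc k) \<le> inverse (r k)"
      using le_imp_inverse_le[OF r_le[of k] r_pos] by simp
    then have "int (Suc k) \<le> \<lfloor>inverse (r k)\<rfloor>"
      by (simp add: le_floor_iff)
    then show ?thesis
      unfolding m_def by linarith
  qed
  have m_pos: "0 < m k" for k
    using m_ge[of k] by simp
  \<comment> \<open>Rounding down costs at most a factor 2, since \<open>m k\<close> is at least 1.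
    Hence the rescaled points stay in the unit cube while the rescaled error stays above
    \<open>\<epsilon> / 2\<close>.\<close>
  have mr: "m k * r k \<le> 1" "1 / 2 \<le> m k * r k" for k
  proof -
    have m: "real (m k) = of_int \<lfloor>inverse (r k)\<rfloor>"
      unfolding m_def using r_pos[of k] by simp
    have "m k \<le> inverse (r k)"
      unfolding m by simp
    then have "m k * r k \<le> inverse (r k) * r k"
      using r_pos[of k] by (intro mult_right_mono) auto
    then show "m k * r k \<le> 1"
      using r_pos[of k] by simp
    have "inverse (r k) \<le> real (m k) + 1"
      unfolding m by linarith
    also have "\<dots> \<le> 2 * real (m k)"
      using m_pos[of k] by simp
    finally have "inverse (r k) * r k \<le> 2 * real (m k) * r k"
      using r_pos[of k] by (intro mult_right_mono) auto
    then show "1 / 2 \<le> m k * r k"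
      using r_pos[of k] by simp
  qed
  define v where "v k = real (m k) *\<^sub>R (1 - y k)" for k
  have y_v: "y k = 1 - v k /\<^sub>R m k" for k
    unfolding v_def using m_pos[of k] by simp
  have v_cbox: "v k \<in> cbox 0 1" for k
  proof -
    have "0 \<le> v k $ i \<and> v k $ i \<le> 1" for i
    proof
      show "0 \<le> v k $ i"
        unfolding v_def using y01 by simp
      have "1 - y k $ i \<le> r k"
        unfolding r_sum using y01 by (intro member_le_sum) auto
      then have "m k * (1 - y k $ i) \<le> m k * r k"
        by (intro mult_left_mono) auto
      also have "\<dots> \<le> 1"
        by (rule mr)
      finally show "v k $ i \<le> 1"
        unfolding v_def by simp
    qed
    then show ?thesis
      by (simp add: mem_box_cart)
  qed
  obtain w s where w: "w \<in> cbox 0 1" and s: "strict_mono (s :: nat \<Rightarrow> nat)" and vw: "(v \<circ> s) \<longlonglongrightarrow> w"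
    using compact_cbox[of 0 1] v_cbox unfolding compact_def by metis
  have w_nonneg: "0 \<le> w $ i" for i
    using w by (simp add: mem_box_cart)
  have vw_i: "(\<lambda>k. v (s k) $ i) \<longlonglongrightarrow> w $ i" for i
    using tendsto_vec_nth[OF vw] by (simp add: comp_def)
  have m_lim: "filterlim (\<lambda>k. m (s k)) sequentially sequentially"
  proof (rule filterlim_at_top_mono)
    show "filterlim (\<lambda>k. k) sequentially sequentially"
      by (rule filterlim_ident)
    show "\<forall>\<^sub>F k in sequentially. k \<le> m (s k)"
      using m_ge strict_mono_imp_increasing[OF s]
      by (intro always_eventually allI) (meson Suc_leD le_trans)
  qed
  have "(\<lambda>n. n * (1 - C (1 - w /\<^sub>R n))) \<longlonglongrightarrow> - ln (G (- w))"
    by (intro tendsto_exp_power multi_df_nonneg[OF df] multi_df_le_1[OF df] lim w_nonneg neg_exp_evd_pos[OF G])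
  from filterlim_compose[OF this m_lim]
  have A: "(\<lambda>k. m (s k) * (1 - C (1 - w /\<^sub>R m (s k)))) \<longlonglongrightarrow> - ln (G (- w))" .
  have B: "(\<lambda>k. m (s k) * (C (y (s k)) - C (1 - w /\<^sub>R m (s k)))) \<longlonglongrightarrow> 0"
  proof (rule Lim_null_comparison)
    show "\<forall>\<^sub>F k in sequentially. norm (m (s k) * (C (y (s k)) - C (1 - w /\<^sub>R m (s k)))) \<le> l1 (v (s k) - w)"
    proof (intro always_eventually allI)
      fix k
      let ?m = "real (m (s k))"
      have "norm (?m * (C (y (s k)) - C (1 - w /\<^sub>R ?m))) = ?m * \<bar>C (y (s k)) - C (1 - w /\<^sub>R ?m)\<bar>"
        by (simp add: abs_mult)
      also have "\<dots> \<le> ?m * (\<Sum>i\<in>UNIV. \<bar>y (s k) $ i - (1 - w /\<^sub>R ?m) $ i\<bar>)"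
        by (intro mult_left_mono copula_Lipschitz C) simp
      also have "\<dots> = (\<Sum>i\<in>UNIV. \<bar>?m * (y (s k) $ i - (1 - w /\<^sub>R ?m) $ i)\<bar>)"
        by (simp add: sum_distrib_left abs_mult)
      also have "\<dots> = l1 (v (s k) - w)"
        unfolding l1_def
      proof (intro sum.cong refl)
        fix i
        have "?m * (y (s k) $ i - (1 - w /\<^sub>R ?m) $ i) = - ((v (s k) - w) $ i)"
          unfolding v_def using m_pos[of "s k"] by (simp add: algebra_simps)
        then show "\<bar>?m * (y (s k) $ i - (1 - w /\<^sub>R ?m) $ i)\<bar> = \<bar>(v (s k) - w) $ i\<bar>"
          by simp
      qed
      finally show "norm (?m * (C (y (s k)) - C (1 - w /\<^sub>R ?m))) \<le> l1 (v (s k) - w)" .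
    qed
    have "(\<lambda>k. \<Sum>i\<in>UNIV. \<bar>v (s k) $ i - w $ i\<bar>) \<longlonglongrightarrow> (\<Sum>i\<in>(UNIV :: 'n set). \<bar>w $ i - w $ i\<bar>)"
      by (intro tendsto_intros vw_i)
    then show "(\<lambda>k. l1 (v (s k) - w)) \<longlonglongrightarrow> 0"
      by (simp add: l1_def)
  qed
  have "(\<lambda>k. G (- v (s k))) \<longlonglongrightarrow> G (- w)"
    by (intro continuous_neg_exp_evd[OF G]) (auto intro!: tendsto_minus vw_i)
  then have D: "(\<lambda>k. ln (G (- v (s k)))) \<longlonglongrightarrow> ln (G (- w))"
    using neg_exp_evd_pos[OF G, of "- w"] by (intro tendsto_ln) auto
  \<comment> \<open>This is \<open>m\<close> times the expansion error at \<open>y\<close>, split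
    into the move from \<open>y\<close> to \<open>1 - w / m\<close>, the limit at the fixed point
    \<open>w\<close>, and \<open>ln G\<close> at \<open>- v\<close>; the three limits
    cancel.\<close>
  have "(\<lambda>k. m (s k) * (C (y (s k)) - C (1 - w /\<^sub>R m (s k))) - m (s k) * (1 - C (1 - w /\<^sub>R m (s k)))
      - ln (G (- v (s k)))) \<longlonglongrightarrow> 0 - (- ln (G (- w))) - ln (G (- w))"
    by (intro tendsto_diff A B D)
  then have "(\<lambda>k. \<bar>m (s k) * (C (y (s k)) - C (1 - w /\<^sub>R m (s k))) - m (s k) * (1 - C (1 - w /\<^sub>R m (s k)))
      - ln (G (- v (s k)))\<bar>) \<longlonglongrightarrow> 0"
    by (intro tendsto_rabs_zero) simp
  moreover have "\<epsilon> / 2 \<le> \<bar>m (s k) * (C (y (s k)) - C (1 - w /\<^sub>R m (s k))) - m (s k) * (1 - C (1 - w /\<^sub>R m (s k)))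
      - ln (G (- v (s k)))\<bar>" for k
  proof -
    let ?m = "real (m (s k))" and ?y = "y (s k)"
    have "y (s k) - 1 = (- v (s k)) /\<^sub>R m (s k)"
      using y_v[of "s k"] by simp
    then have "ln (G (?y - 1)) = ln (G (- v (s k))) / ?m"
      using neg_exp_evd_ln_scale[OF G, of "m (s k)" "- v (s k)"] m_pos[of "s k"] by simp
    then have eq: "ln (G (- v (s k))) = ?m * ln (G (?y - 1))"
      using m_pos[of "s k"] by simp
    have "\<epsilon> / 2 \<le> \<epsilon> * (?m * r (s k))"
      using mult_left_mono[OF mr(2)[of "s k"], of \<epsilon>] \<epsilon> by simp
    also have "\<dots> = ?m * (\<epsilon> * r (s k))"
      by simp
    also have "\<dots> \<le> ?m * \<bar>C ?y - (1 + ln (G (?y - 1)))\<bar>"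
      using y(3)[of "s k"] unfolding r_def by (intro mult_left_mono) auto
    also have "\<dots> = \<bar>?m * (C ?y - (1 + ln (G (?y - 1))))\<bar>"
      by (simp add: abs_mult)
    also have "?m * (C ?y - (1 + ln (G (?y - 1)))) =
        ?m * (C ?y - C (1 - w /\<^sub>R m (s k))) - ?m * (1 - C (1 - w /\<^sub>R m (s k))) - ln (G (- v (s k)))"
      unfolding eq by (simp add: algebra_simps)
    finally show ?thesis .
  qed
  ultimately have "\<epsilon> / 2 \<le> 0"
    by (intro LIMSEQ_le_const) auto
  with \<epsilon> show False
    by simp
qed

theorem theorem2p1:
  fixes F C N :: "real ^ 'n::finite \<Rightarrow> real"
  assumes "multi_df F"
    and "copula_of C F"
    and "is_norm N"
  shows "(\<exists>G. evd G \<and> domain_of_attraction F G) \<longleftrightarrow>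
    ((\<forall>i. \<exists>g. univ_evd g \<and> univ_domain_of_attraction (margin F i) g) \<and>
     (\<exists>W. gpd_ultimately_uniform W \<and>
        (\<forall>\<epsilon>>0. \<exists>\<delta>>0. \<forall>y\<in>{0..1}. N (y - 1) \<le> \<delta> \<longrightarrow>
           \<bar>C y - W (y - 1)\<bar> \<le> \<epsilon> * N (y - 1))))"
proof
  have C: "copula C"
    using assms(2) by (simp add: copula_of_def)
  show "(\<forall>i. \<exists>g. univ_evd g \<and> univ_domain_of_attraction (margin F i) g) \<and>
     (\<exists>W. gpd_ultimately_uniform W \<and>
        (\<forall>\<epsilon>>0. \<exists>\<delta>>0. \<forall>y\<in>{0..1}. N (y - 1) \<le> \<delta> \<longrightarrow>
           \<bar>C y - W (y - 1)\<bar> \<le> \<epsilon> * N (y - 1)))"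
    if domain: "\<exists>G. evd G \<and> domain_of_attraction F G"
  proof
    obtain G where G: "evd G" "domain_of_attraction F G"
      using domain by blast
    obtain a b where a: "\<And>n i. 0 < a n $ i" and lim: "\<And>x. (\<lambda>n. F (a n * x + b n) ^ n) \<longlonglongrightarrow> G x"
      using G(2) unfolding domain_of_attraction_def by blast
    have "multi_df G"
      using G(1) by (simp add: evd_def)
    then have "(\<lambda>n. margin F i (a n $ i * t + b n $ i) ^ n) \<longlonglongrightarrow> margin G i t" for i t
      by (rule domain_of_attraction_margin[OF assms(1) _ a lim])
    then have "univ_domain_of_attraction (margin F i) (margin G i)" for i
      unfolding univ_domain_of_attraction_def using a
      by (intro exI[of _ "\<lambda>n. a n $ i"] exI[of _ "\<lambda>n. b n $ i"]) auto
    then show "\<forall>i. \<exists>g. univ_evd g \<and> univ_domain_of_attraction (margin F i) g"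
      using univ_evd_margin[OF G(1)] by blast
    obtain H where H: "neg_exp_evd H"
      and CH: "\<And>v. (\<And>i. 0 \<le> v $ i) \<Longrightarrow> (\<lambda>n. C (1 - v /\<^sub>R n) ^ n) \<longlonglongrightarrow> H (- v)"
      by (rule copula_power_limit_of_domain[OF assms(1,2) G]) blast
    obtain W x0 where W: "gpd_ultimately_uniform W" and x0: "\<And>i. x0 $ i < 0"
      and tail: "\<And>x. x0 \<le> x \<Longrightarrow> W x = 1 + ln (H x)"
      by (rule gpd_ultimately_uniform_exists[OF H]) blast
    obtain c where c: "0 < c" "\<And>v. c * (\<Sum>i\<in>UNIV. \<bar>v $ i\<bar>) \<le> N v"
      by (rule is_norm_lower_bound[OF assms(3)]) blast
    have "\<exists>\<delta>>0. \<forall>y\<in>{0..1}. N (y - 1) \<le> \<delta> \<longrightarrow> \<bar>C y - W (y - 1)\<bar> \<le> \<epsilon> * N (y - 1)"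
      if \<epsilon>: "0 < \<epsilon>" for \<epsilon>
    proof -
      have "0 < \<epsilon> * c"
        using \<epsilon> c(1) by simp
      then obtain \<delta> where \<delta>: "0 < \<delta>" "\<forall>y\<in>{0..1}. (\<Sum>i\<in>UNIV. \<bar>(y - 1) $ i\<bar>) \<le> \<delta> \<longrightarrow>
          \<bar>C y - (1 + ln (H (y - 1)))\<bar> \<le> \<epsilon> * c * (\<Sum>i\<in>UNIV. \<bar>(y - 1) $ i\<bar>)"
        using copula_expansion[OF C H CH] by blast
      \<comment> \<open>Besides the bound \<open>\<delta>\<close>, the l1 distance must be so small
        that \<open>y - 1\<close> lies above \<open>x0\<close>, where \<open>W\<close> equals
        \<open>1 + ln H\<close>.\<close>
      define \<eta> where "\<eta> = Min (insert \<delta> (range (\<lambda>i. - x0 $ i)))"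
      have \<eta>: "0 < \<eta>" "\<eta> \<le> \<delta>" "\<eta> \<le> - x0 $ i" for i
        unfolding \<eta>_def using \<delta>(1) x0 by (auto intro!: Min_le simp del: Min_insert)
      have "\<bar>C y - W (y - 1)\<bar> \<le> \<epsilon> * N (y - 1)" if y: "y \<in> {0..1}" "N (y - 1) \<le> c * \<eta>" for y
      proof -
        let ?s = "\<Sum>i\<in>UNIV. \<bar>(y - 1) $ i\<bar>"
        have "c * ?s \<le> c * \<eta>"
          using c(2)[of "y - 1"] y(2) by linarith
        then have s: "?s \<le> \<eta>"
          using c(1) by simp
        have "x0 $ i \<le> (y - 1) $ i" for i
        proof -
          have "\<bar>(y - 1) $ i\<bar> \<le> ?s"
            by (intro member_le_sum) auto
          then show ?thesis
            using s \<eta>(3)[of i] by linarith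
        qed
        then have "x0 \<le> y - 1"
          by (simp add: less_eq_vec_def)
        then have "\<bar>C y - W (y - 1)\<bar> = \<bar>C y - (1 + ln (H (y - 1)))\<bar>"
          by (simp only: tail)
        also have "\<dots> \<le> \<epsilon> * (c * ?s)"
          using \<delta>(2)[rule_format, OF y(1) order_trans[OF s \<eta>(2)]] by (simp only: mult.assoc)
        also have "\<dots> \<le> \<epsilon> * N (y - 1)"
          using \<epsilon> by (intro mult_left_mono c) simp
        finally show ?thesis .
      qed
      then show ?thesis
        using c(1) \<eta>(1) by (intro exI[of _ "c * \<eta>"]) simp
    qed
    with W show "\<exists>W. gpd_ultimately_uniform W \<and>
        (\<forall>\<epsilon>>0. \<exists>\<delta>>0. \<forall>y\<in>{0..1}. N (y - 1) \<le> \<delta> \<longrightarrow> \<bar>C y - W (y - 1)\<bar> \<le> \<epsilon> * N (y - 1))"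
      by blast
  qed
  show "\<exists>G. evd G \<and> domain_of_attraction F G"
    if conditions: "(\<forall>i. \<exists>g. univ_evd g \<and> univ_domain_of_attraction (margin F i) g) \<and>
     (\<exists>W. gpd_ultimately_uniform W \<and>
        (\<forall>\<epsilon>>0. \<exists>\<delta>>0. \<forall>y\<in>{0..1}. N (y - 1) \<le> \<delta> \<longrightarrow>
           \<bar>C y - W (y - 1)\<bar> \<le> \<epsilon> * N (y - 1)))"
  proof -
    obtain W where W: "gpd_ultimately_uniform W"
      and expansion: "\<forall>\<epsilon>>0. \<exists>\<delta>>0. \<forall>y\<in>{0..1}. N (y - 1) \<le> \<delta> \<longrightarrow> \<bar>C y - W (y - 1)\<bar> \<le> \<epsilon> * N (y - 1)"
      using conditions by blast
    obtain x0 G where x0: "\<And>i. x0 $ i < 0" and G: "neg_exp_evd G" and tail: "gp_tail W G {x0..0}"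
      using W unfolding gpd_ultimately_uniform_def neg_exp_evd_def by blast
    have "(\<lambda>n. C (1 - v /\<^sub>R n) ^ n) \<longlonglongrightarrow> G (- v)" if "\<And>i. 0 \<le> v $ i" for v
      by (rule copula_power_limit_of_expansion[OF C G assms(3) x0 tail expansion that])
    then show ?thesis
      using conditions by (intro domain_of_attraction_of_copula[OF assms(1,2) G]) auto
  qed
qed

end
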